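(* For constrained persuasion with unique rejects there is a polynomial-time algorithm to compute an optimal signaling scheme $\varphi^*$.
   Context: Constrained persuasion. An instance consists of a finite set $\Theta$ of states partitioned as $\Theta=\Theta_A\sqcup\Theta_R$ (acceptable and rejectable states), a finite set $\Sigma$ of signals, rational probabilities $q_\theta>0$ with $\sum_\theta q_\theta=1$, and a bipartite graph $H=(\Theta\cup\Sigma,E)$, $E\subseteq\Theta\times\Sigma$, without isolated vertices; $(\theta,\sigma)\in E$ means that $\sigma$ may be sent in state $\theta$, and $N(\cdot)$ denotes neighborhoods. The sender commits to a signaling scheme $\varphi:E\to[0,1]$ with $\sum_{\sigma\in N(\theta)}\varphi(\theta,\sigma)=q_\theta$ for all $\theta\in\Theta$. The receiver accepts on signal $\sigma$ if and only if $\sum_{\theta\in N(\sigma)\cap\Theta_A}\varphi(\theta,\sigma)\ge\sum_{\theta\in N(\sigma)\cap\Theta_R}\varphi(\theta,\sigma)$ (ties broken in favor of accepting); then $\sigma$ is an accept signal. The sender's utility is $\sum_{\sigma\text{ accept signal}}\sum_{\theta\in N(\sigma)}\varphi(\theta,\sigma)$. An optimal signaling scheme $\varphi^*$ maximizes it. Unique rejects: $|\Theta_R|=1$. *)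

theory Defs
  imports Complex_Main "HOL-Library.Log_Nat" "HOL-Computational_Algebra.Polynomial"
begin

section \<open>Constrained persuasion\<close>

record ('s, 'g) persuasion =
  acc :: "'s set"
  rej :: "'s set"
  signals :: "'g set"
  prob :: "'s \<Rightarrow> rat"
  edges :: "('s \<times> 'g) set"

definition states :: "('s, 'g) persuasion \<Rightarrow> 's set" where
  "states I = acc I \<union> rej I"

definition nbs_state :: "('s, 'g) persuasion \<Rightarrow> 's \<Rightarrow> 'g set" where
  "nbs_state I \<theta> = {\<sigma>. (\<theta>, \<sigma>) \<in> edges I}"

definition nbs_signal :: "('s, 'g) persuasion \<Rightarrow> 'g \<Rightarrow> 's set" where
  "nbs_signal I \<sigma> = {\<theta>. (\<theta>, \<sigma>) \<in> edges I}"

definition constrained_persuasion :: "('s, 'g) persuasion \<Rightarrow> bool" where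
  "constrained_persuasion I \<longleftrightarrow>
     finite (states I) \<and> acc I \<inter> rej I = {} \<and> finite (signals I) \<and>
     (\<forall>\<theta>\<in>states I. prob I \<theta> > 0) \<and> (\<Sum>\<theta>\<in>states I. prob I \<theta>) = 1 \<and>
     edges I \<subseteq> states I \<times> signals I \<and>
     (\<forall>\<theta>\<in>states I. nbs_state I \<theta> \<noteq> {}) \<and> (\<forall>\<sigma>\<in>signals I. nbs_signal I \<sigma> \<noteq> {})"

definition unique_rejects :: "('s, 'g) persuasion \<Rightarrow> bool" where
  "unique_rejects I \<longleftrightarrow> card (rej I) = 1"

text \<open>
  A scheme is a function on the edge set; in HOL it is a total function whose values off the
  edge set are unconstrained and never used. Schemes range over the reals although the
  probabilities are rational.
\<close>

definition signaling_scheme :: "('s, 'g) persuasion \<Rightarrow> ('s \<times> 'g \<Rightarrow> real) \<Rightarrow> bool" where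
  "signaling_scheme I \<phi> \<longleftrightarrow>
     (\<forall>e\<in>edges I. 0 \<le> \<phi> e \<and> \<phi> e \<le> 1) \<and>
     (\<forall>\<theta>\<in>states I. (\<Sum>\<sigma>\<in>nbs_state I \<theta>. \<phi> (\<theta>, \<sigma>)) = of_rat (prob I \<theta>))"

definition accept_signals :: "('s, 'g) persuasion \<Rightarrow> ('s \<times> 'g \<Rightarrow> real) \<Rightarrow> 'g set" where
  "accept_signals I \<phi> =
     {\<sigma>\<in>signals I. (\<Sum>\<theta>\<in>nbs_signal I \<sigma> \<inter> acc I. \<phi> (\<theta>, \<sigma>))
                   \<ge> (\<Sum>\<theta>\<in>nbs_signal I \<sigma> \<inter> rej I. \<phi> (\<theta>, \<sigma>))}"

definition sender_utility :: "('s, 'g) persuasion \<Rightarrow> ('s \<times> 'g \<Rightarrow> real) \<Rightarrow> real" where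
  "sender_utility I \<phi> = (\<Sum>\<sigma>\<in>accept_signals I \<phi>. \<Sum>\<theta>\<in>nbs_signal I \<sigma>. \<phi> (\<theta>, \<sigma>))"

definition optimal_scheme :: "('s, 'g) persuasion \<Rightarrow> ('s \<times> 'g \<Rightarrow> real) \<Rightarrow> bool" where
  "optimal_scheme I \<phi> \<longleftrightarrow>
     signaling_scheme I \<phi> \<and>
     (\<forall>\<psi>. signaling_scheme I \<psi> \<longrightarrow> sender_utility I \<psi> \<le> sender_utility I \<phi>)"


section \<open>Random access machines with logarithmic cost\<close>

text \<open>
  The machine model is the random access machine with the logarithmic cost criterion, programmed
  by structured commands. Storage cells hold natural numbers and are addressed by an array name
  and an index (the finitely many arrays of a program can be interleaved in a single memory;
  a scalar variable is an array of which only cell 0 is used). Every operation is charged the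
  binary lengths of its operands and of the addresses involved, so that time on this machine is
  polynomially related to time on a Turing machine.
\<close>

definition nat_size :: "nat \<Rightarrow> nat" where
  \<comment> \<open>number of binary digits plus one, so that 0 also has positive size\<close>
  "nat_size k = Suc (floorlog 2 k)"

type_synonym store = "string \<Rightarrow> nat \<Rightarrow> nat"

datatype expr =
    Const nat
  | Cell string expr
  | Plus expr expr
  | Monus expr expr
  | Times expr expr
  | Div expr expr

fun val :: "expr \<Rightarrow> store \<Rightarrow> nat" where
  "val (Const k) s = k"
| "val (Cell x e) s = s x (val e s)"
| "val (Plus a b) s = val a s + val b s"
| "val (Monus a b) s = val a s - val b s"
| "val (Times a b) s = val a s * val b s"
| "val (Div a b) s = val a s div val b s"

fun cost :: "expr \<Rightarrow> store \<Rightarrow> nat" where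
  "cost (Const k) s = nat_size k"
| "cost (Cell x e) s = cost e s + nat_size (val e s) + nat_size (s x (val e s))"
| "cost (Plus a b) s = cost a s + cost b s + nat_size (val a s) + nat_size (val b s)"
| "cost (Monus a b) s = cost a s + cost b s + nat_size (val a s) + nat_size (val b s)"
| "cost (Times a b) s = cost a s + cost b s + nat_size (val a s) + nat_size (val b s)"
| "cost (Div a b) s = cost a s + cost b s + nat_size (val a s) + nat_size (val b s)"

datatype com =
    Skip
  | Assign string expr expr  \<comment> \<open>\<open>Assign x i e\<close> is \<open>x[i] := e\<close>\<close>
  | Seq com com
  | If expr com com
  | While expr com

definition assign_store :: "store \<Rightarrow> string \<Rightarrow> nat \<Rightarrow> nat \<Rightarrow> store" where
  "assign_store s x i k = s(x := (s x)(i := k))"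

text \<open>
  \<open>exec c s t s'\<close>: started in \<open>s\<close>, the program \<open>c\<close> halts in \<open>s'\<close> and takes time \<open>t\<close>.
  Tests succeed on nonzero values.
\<close>

inductive exec :: "com \<Rightarrow> store \<Rightarrow> nat \<Rightarrow> store \<Rightarrow> bool" where
  Skip: "exec Skip s 1 s"
| Assign: "exec (Assign x i e) s
     (cost i s + cost e s + nat_size (val i s) + nat_size (val e s))
     (assign_store s x (val i s) (val e s))"
| Seq: "exec c s t s' \<Longrightarrow> exec d s' t' s'' \<Longrightarrow> exec (Seq c d) s (t + t') s''"
| IfTrue: "val b s \<noteq> 0 \<Longrightarrow> exec c s t s' \<Longrightarrow>
     exec (If b c d) s (cost b s + nat_size (val b s) + t) s'"
| IfFalse: "val b s = 0 \<Longrightarrow> exec d s t s' \<Longrightarrow>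
     exec (If b c d) s (cost b s + nat_size (val b s) + t) s'"
| WhileFalse: "val b s = 0 \<Longrightarrow>
     exec (While b c) s (cost b s + nat_size (val b s)) s"
| WhileTrue: "val b s \<noteq> 0 \<Longrightarrow> exec c s t s' \<Longrightarrow> exec (While b c) s' t' s'' \<Longrightarrow>
     exec (While b c) s (cost b s + nat_size (val b s) + t + t') s''"

lemma exec_deterministic:
  "exec c s t s' \<Longrightarrow> exec c s u s'' \<Longrightarrow> u = t \<and> s'' = s'"
proof (induction arbitrary: u s'' rule: exec.induct)
  case (Skip s)
  from Skip.prems show ?case by cases simp_all
next
  case (Assign x i e s)
  from Assign.prems show ?case by cases simp_all
next
  case (Seq c s t s' d t' s3)
  from Seq.prems show ?case by cases (auto dest!: Seq.IH)
next
  case (IfTrue b s c t s' d)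
  from IfTrue.prems show ?case by cases (use IfTrue.hyps in \<open>auto dest: IfTrue.IH\<close>)
next
  case (IfFalse b s d t s' c)
  from IfFalse.prems show ?case by cases (use IfFalse.hyps in \<open>auto dest: IfFalse.IH\<close>)
next
  case (WhileFalse b s c)
  from WhileFalse.prems show ?case by cases (use WhileFalse.hyps in simp_all)
next
  case (WhileTrue b s c t s' t' s3)
  from WhileTrue.prems show ?case
    by cases (use WhileTrue.hyps in \<open>auto dest!: WhileTrue.IH\<close>)
qed

definition list_size :: "nat list \<Rightarrow> nat" where
  "list_size xs = (\<Sum>x\<leftarrow>xs. nat_size x)"

definition input_store :: "nat list \<Rightarrow> store" where
  "input_store xs = (\<lambda>_ _. 0)
     (''inlen'' := (\<lambda>_. 0)(0 := length xs),
      ''in'' := (\<lambda>i. if i < length xs then xs ! i else 0))"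

definition output_of :: "store \<Rightarrow> nat list" where
  "output_of s = map (s ''out'') [0..<s ''outlen'' 0]"

text \<open>
  Search problems: \<open>X\<close> is the set of instances, \<open>enc\<close> their encoding as inputs, and
  \<open>sol I ys\<close> says that \<open>ys\<close> is a correct output for \<open>I\<close>. Writing a length into
  \<open>''outlen''\<close> is cheap even if it is huge, hence the time bound includes reading off the output.
\<close>

definition poly_time_solvable ::
    "'i set \<Rightarrow> ('i \<Rightarrow> nat list) \<Rightarrow> ('i \<Rightarrow> nat list \<Rightarrow> bool) \<Rightarrow> bool" where
  "poly_time_solvable X enc sol \<longleftrightarrow>
     (\<exists>(c :: com) (p :: nat poly). \<forall>I\<in>X. \<exists>t s.
        exec c (input_store (enc I)) t s \<and>
        t + length (output_of s) \<le> poly p (list_size (enc I)) \<and>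
        sol I (output_of s))"


section \<open>Encoding of instances and schemes\<close>

text \<open>
  For the purposes of input and output, the states and the signals are numbered from 0.
\<close>

definition numbered :: "(nat, nat) persuasion \<Rightarrow> bool" where
  "numbered I \<longleftrightarrow>
     states I = {..<card (states I)} \<and> signals I = {..<card (signals I)}"

text \<open>
  An instance with \<open>n\<close> states and \<open>m\<close> signals is given as \<open>n\<close>, \<open>m\<close>, then for each state its
  acceptability bit and the numerator and denominator of its probability in lowest terms, then
  the \<open>n \<times> m\<close> adjacency matrix, row by row.
\<close>

definition encode_instance :: "(nat, nat) persuasion \<Rightarrow> nat list" where
  "encode_instance I =
     (let n = card (states I); m = card (signals I) in
        [n, m] @
        concat (map (\<lambda>\<theta>. [of_bool (\<theta> \<in> acc I),
                          nat (fst (quotient_of (prob I \<theta>))),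
                          nat (snd (quotient_of (prob I \<theta>)))]) [0..<n]) @
        concat (map (\<lambda>\<theta>. map (\<lambda>\<sigma>. of_bool ((\<theta>, \<sigma>) \<in> edges I)) [0..<m]) [0..<n]))"

text \<open>
  A scheme is given as an \<open>n \<times> m\<close> matrix of fractions, row by row, each as a numerator followed
  by a nonzero denominator, not necessarily in lowest terms.
\<close>

definition decode_scheme :: "nat \<Rightarrow> nat list \<Rightarrow> nat \<times> nat \<Rightarrow> real" where
  "decode_scheme m ys = (\<lambda>(\<theta>, \<sigma>).
     real (ys ! (2 * (\<theta> * m + \<sigma>))) / real (ys ! (2 * (\<theta> * m + \<sigma>) + 1)))"

definition encodes_optimal_scheme :: "(nat, nat) persuasion \<Rightarrow> nat list \<Rightarrow> bool" where
  "encodes_optimal_scheme I ys \<longleftrightarrow>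
     (let n = card (states I); m = card (signals I) in
        length ys = 2 * (n * m) \<and>
        (\<forall>k<n * m. ys ! (2 * k + 1) \<noteq> 0) \<and>
        optimal_scheme I (decode_scheme m ys))"

end

theory Submission
  imports Defs
begin

text \<open>
  Let \<open>r\<close> be the only rejectable state and \<open>S\<close> its neighborhood. If the acceptable states with a
  neighbor in \<open>S\<close> have at least the mass of \<open>r\<close>, they can be sent into \<open>S\<close> and cover \<open>r\<close>
  completely, so that every signal is accepted. Otherwise every scheme rejects some \<open>z \<in> S\<close>. With \<open>z\<close>
  rejected, a unit of mass of an acceptable state is worth 2 on a signal of \<open>S - {z}\<close> (it also covers
  a unit of \<open>r\<close>), 1 outside \<open>S\<close>, and 0 on \<open>z\<close>; since there is more than enough of \<open>r\<close>, all states can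
  choose their best signal independently, and what is left of \<open>r\<close> is sent on \<open>z\<close>. It remains to try
  all \<open>z \<in> S\<close>. The arithmetic is done with integers over the product of all denominators, whose
  length is bounded by the length of the input.
\<close>

section \<open>Verification of running times\<close>

text \<open>Acceptance depends discontinuously on the scheme, and \<open>r\<close> may have many
  rejected signals, so a search over subsets of \<open>S\<close> might seem necessary. One rejected
  \<open>z\<close> is enough: \<open>gain z\<close> bounds the utility of every scheme that rejects
  \<open>z\<close>, whatever happens on the other signals, because an accepted signal of
  \<open>r\<close> is worth at most twice its acceptable mass and a rejected one is worth nothing.
  The independent choices attain this bound exactly because \<open>cover z < q r\<close>, so that
  \<open>r\<close> never runs out while it is being matched. Both cases of the algorithm go through
  one construction: when nothing has to be rejected, \<open>z\<close> is a number that is not a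
  signal, and then nothing of \<open>r\<close> is left over. On the machine side no assertion
  mentions time. If all cells keep at most \<open>K\<close> bits and all loops make at most
  \<open>K\<close> iterations, the program text alone determines a polynomial time bound in
  \<open>K\<close>. What remains for each assignment is a size bound, and these come from the fact
  that the scaled masses add up to the common denominator.\<close>

fun width :: "expr \<Rightarrow> nat" where
  "width (Const k) = nat_size k"
| "width (Cell x e) = 1"
| "width (Plus a b) = width a + width b"
| "width (Monus a b) = width a"
| "width (Times a b) = width a + width b"
| "width (Div a b) = width a"

definition bounded_store :: "nat \<Rightarrow> store \<Rightarrow> bool" where
  "bounded_store K s \<longleftrightarrow> 0 < K \<and> (\<forall>x i. s x i < 2 ^ K)"

lemma less_two_power_floorlog: "k < 2 ^ floorlog 2 k"
proof (cases "k = 0")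
  case False
  then show ?thesis using floorlog_bounds[of k 2] by simp
qed simp

lemma less_two_power_nat_size: "k < 2 ^ nat_size k"
  using less_two_power_floorlog[of k] unfolding nat_size_def
  by (simp add: less_le_trans)

lemma nat_size_le: "k < 2 ^ j \<Longrightarrow> nat_size k \<le> Suc j"
  by (simp add: nat_size_def floorlog_le_iff floorlog_leI)

lemma width_pos: "0 < width e"
  by (induction e) (auto simp: nat_size_def)

text \<open>Bit lengths are kept as pure multiples of \<open>K\<close>, without additive terms, so
  that they compose. A sum is therefore given the width of a product: both powers of two are at
  least 2, and \<open>x + y \<le> x * y\<close> for such numbers. A cell has width 1 whatever its
  address is.\<close>

lemma val_less_width:
  assumes "bounded_store K s"
  shows "val e s < 2 ^ (width e * K)"
proof (induction e)
  case (Const k)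
  have "(2::nat) ^ nat_size k \<le> 2 ^ (nat_size k * K)"
    using assms by (intro power_increasing) (auto simp: bounded_store_def)
  then show ?case using less_two_power_nat_size[of k] by (metis less_le_trans val.simps(1) width.simps(1))
next
  case (Cell x e)
  then show ?case using assms by (simp add: bounded_store_def)
next
  case (Plus a b)
  have sum_le_product: "x + y \<le> x * y" if "2 \<le> x" "2 \<le> y" for x y :: nat
    using mult_le_mono1[OF that(1), of y] mult_le_mono2[OF that(2), of x] by linarith
  have pos: "1 \<le> width a * K" "1 \<le> width b * K"
    using assms width_pos[of a] width_pos[of b] by (simp_all add: bounded_store_def Suc_le_eq)
  then have "(2::nat) ^ 1 \<le> 2 ^ (width a * K)" "(2::nat) ^ 1 \<le> 2 ^ (width b * K)"
    by (intro power_increasing; simp)+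
  then have "(2::nat) ^ (width a * K) + 2 ^ (width b * K) \<le> 2 ^ (width a * K) * 2 ^ (width b * K)"
    using sum_le_product by simp
  then show ?case using Plus by (simp add: algebra_simps power_add)
next
  case (Times a b)
  then show ?case by (simp add: algebra_simps power_add mult_strict_mono)
next
  case (Monus a b)
  then show ?case by (simp add: less_imp_diff_less)
next
  case (Div a b)
  then show ?case using div_le_dividend le_less_trans by (metis val.simps(6) width.simps(6))
qed

lemma nat_size_val_le:
  assumes "bounded_store K s"
  shows "nat_size (val e s) \<le> Suc (width e) * K"
  using nat_size_le[OF val_less_width[OF assms, of e]] assms by (simp add: bounded_store_def)

text \<open>The coefficient of \<open>K\<close> in the cost. Every operand contributes its width
  plus one; the extra one absorbs the successor in \<open>nat_size_le\<close>, because
  \<open>K\<close> is positive.\<close>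

fun cost_rate :: "expr \<Rightarrow> nat" where
  "cost_rate (Const k) = nat_size k"
| "cost_rate (Cell x e) = cost_rate e + width e + 3"
| "cost_rate (Plus a b) = cost_rate a + cost_rate b + width a + width b + 2"
| "cost_rate (Monus a b) = cost_rate a + cost_rate b + width a + width b + 2"
| "cost_rate (Times a b) = cost_rate a + cost_rate b + width a + width b + 2"
| "cost_rate (Div a b) = cost_rate a + cost_rate b + width a + width b + 2"

lemma cost_le:
  assumes "bounded_store K s"
  shows "cost e s \<le> cost_rate e * K"
proof (induction e)
  case (Const k)
  then show ?case using assms by (simp add: bounded_store_def)
next
  case (Cell x e)
  have "nat_size (s x (val e s)) \<le> 2 * K"
    using nat_size_val_le[OF assms, of "Cell x e"] by simp
  then show ?case using Cell nat_size_val_le[OF assms, of e] by (simp add: algebra_simps)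
next
  case (Plus a b)
  then show ?case using nat_size_val_le[OF assms, of a] nat_size_val_le[OF assms, of b]
    by (simp add: algebra_simps)
next
  case (Monus a b)
  then show ?case using nat_size_val_le[OF assms, of a] nat_size_val_le[OF assms, of b]
    by (simp add: algebra_simps)
next
  case (Times a b)
  then show ?case using nat_size_val_le[OF assms, of a] nat_size_val_le[OF assms, of b]
    by (simp add: algebra_simps)
next
  case (Div a b)
  then show ?case using nat_size_val_le[OF assms, of a] nat_size_val_le[OF assms, of b]
    by (simp add: algebra_simps)
qed

text \<open>
  Time of a program all of whose loops make at most \<open>K\<close> iterations, in stores whose cells have
  at most \<open>K\<close> bits. Such a bound is a polynomial in \<open>K\<close> that can be read off the program text.
\<close>

fun time_bound :: "com \<Rightarrow> nat \<Rightarrow> nat" where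
  "time_bound Skip K = 1"
| "time_bound (Assign x i e) K = (cost_rate i + cost_rate e + width i + width e + 2) * K"
| "time_bound (Seq c d) K = time_bound c K + time_bound d K"
| "time_bound (If b c d) K = (cost_rate b + width b + 1) * K + time_bound c K + time_bound d K"
| "time_bound (While b c) K = Suc K * ((cost_rate b + width b + 1) * K + time_bound c K)"

lemma time_bound_poly: "\<exists>p :: nat poly. \<forall>K. time_bound c K = poly p K"
proof (induction c)
  case Skip
  show ?case by (rule exI[of _ 1]) simp
next
  case (Assign x i e)
  show ?case
    by (rule exI[of _ "[:0, cost_rate i + cost_rate e + width i + width e + 2:]"]) simp
next
  case (Seq c d)
  then obtain p q :: "nat poly" where "\<forall>K. time_bound c K = poly p K" "\<forall>K. time_bound d K = poly q K"
    by blast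
  then show ?case by (intro exI[of _ "p + q"]) simp
next
  case (If b c d)
  then obtain p q :: "nat poly" where "\<forall>K. time_bound c K = poly p K" "\<forall>K. time_bound d K = poly q K"
    by blast
  then show ?case by (intro exI[of _ "[:0, cost_rate b + width b + 1:] + p + q"]) simp
next
  case (While b c)
  then obtain p :: "nat poly" where "\<forall>K. time_bound c K = poly p K"
    by blast
  then show ?case by (intro exI[of _ "[:1, 1:] * ([:0, cost_rate b + width b + 1:] + p)"]) simp
qed

section \<open>A program logic with built-in frame, size and time bounds\<close>

fun assigned :: "com \<Rightarrow> string set" where
  "assigned Skip = {}"
| "assigned (Assign x i e) = {x}"
| "assigned (Seq c d) = assigned c \<union> assigned d"
| "assigned (If b c d) = assigned c \<union> assigned d"
| "assigned (While b c) = assigned c"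

lemma exec_frame: "exec c s t s' \<Longrightarrow> x \<notin> assigned c \<Longrightarrow> s' x = s x"
  by (induction rule: exec.induct) (auto simp: assign_store_def)

text \<open>Total correctness with the time bound fixed by the program text. Boundedness of the
  store is assumed before and guaranteed after, so a proof only has to show what is computed, that
  assigned values have at most \<open>K\<close> bits and that loops run at most \<open>K\<close>
  times.\<close>

definition wp :: "nat \<Rightarrow> com \<Rightarrow> (store \<Rightarrow> bool) \<Rightarrow> store \<Rightarrow> bool" where
  "wp K c Q s \<longleftrightarrow> (bounded_store K s \<longrightarrow>
     (\<exists>t s'. exec c s t s' \<and> t \<le> time_bound c K \<and> bounded_store K s' \<and> Q s'))"

lemma wp_conseq:
  assumes "wp K c P s"
    and "\<And>s'. (\<And>x. x \<notin> assigned c \<Longrightarrow> s' x = s x) \<Longrightarrow> bounded_store K s' \<Longrightarrow> P s' \<Longrightarrow> Q s'"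
  shows "wp K c Q s"
  using assms unfolding wp_def by (meson exec_frame)

lemma wp_Skip: "Q s \<Longrightarrow> wp K Skip Q s"
  unfolding wp_def by (auto intro!: exI exec.Skip)

text \<open>The only rule with a size obligation. It may use the boundedness of the current store,
  which settles assignments that merely copy a cell.\<close>

lemma wp_Assign:
  assumes "bounded_store K s \<Longrightarrow> val e s < 2 ^ K"
    and "Q (assign_store s x (val i s) (val e s))"
  shows "wp K (Assign x i e) Q s"
  unfolding wp_def
proof (intro impI exI conjI)
  assume b: "bounded_store K s"
  show "exec (Assign x i e) s (cost i s + cost e s + nat_size (val i s) + nat_size (val e s))
    (assign_store s x (val i s) (val e s))"
    by (rule exec.Assign)
  show "cost i s + cost e s + nat_size (val i s) + nat_size (val e s) \<le> time_bound (Assign x i e) K"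
    using cost_le[OF b, of i] cost_le[OF b, of e] nat_size_val_le[OF b, of i] nat_size_val_le[OF b, of e]
    by (simp add: algebra_simps)
  show "bounded_store K (assign_store s x (val i s) (val e s))"
    using b assms(1)[OF b] by (simp add: bounded_store_def assign_store_def)
qed (rule assms(2))

lemma wp_Seq: "wp K c (wp K d Q) s \<Longrightarrow> wp K (Seq c d) Q s"
  unfolding wp_def by (fastforce intro: exec.Seq add_mono)

text \<open>The superset \<open>A\<close> lets the frame condition be stated with an explicit list
  of array names, without unfolding the program.\<close>

lemma wp_then:
  assumes "wp K c P s" and "assigned c \<subseteq> A"
    and "\<And>s'. (\<And>x. x \<notin> A \<Longrightarrow> s' x = s x) \<Longrightarrow> P s' \<Longrightarrow> wp K d Q s'"
  shows "wp K (Seq c d) Q s"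
  by (rule wp_Seq, rule wp_conseq[OF assms(1)], rule assms(3)) (use assms(2) in auto)

lemma wp_If:
  assumes "val b s \<noteq> 0 \<Longrightarrow> wp K c Q s" and "val b s = 0 \<Longrightarrow> wp K d Q s"
  shows "wp K (If b c d) Q s"
  unfolding wp_def
proof
  assume B: "bounded_store K s"
  have le: "cost b s + nat_size (val b s) \<le> (cost_rate b + width b + 1) * K"
    using cost_le[OF B, of b] nat_size_val_le[OF B, of b] by (simp add: algebra_simps)
  show "\<exists>t s'. exec (If b c d) s t s' \<and> t \<le> time_bound (If b c d) K \<and> bounded_store K s' \<and> Q s'"
  proof (cases "val b s = 0")
    case True
    then obtain t s' where "exec d s t s'" "t \<le> time_bound d K" "bounded_store K s'" "Q s'"
      using assms(2) B unfolding wp_def by blast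
    then show ?thesis using le exec.IfFalse[OF True, of d t s' c]
      by (intro exI[of _ s'] exI[of _ "cost b s + nat_size (val b s) + t"]) simp
  next
    case False
    then obtain t s' where "exec c s t s'" "t \<le> time_bound c K" "bounded_store K s'" "Q s'"
      using assms(1) B unfolding wp_def by blast
    then show ?thesis using le exec.IfTrue[OF False, of c t s' d]
      by (intro exI[of _ s'] exI[of _ "cost b s + nat_size (val b s) + t"]) simp
  qed
qed

abbreviation var :: "string \<Rightarrow> expr" where
  "var x \<equiv> Cell x (Const 0)"

abbreviation set_var :: "string \<Rightarrow> expr \<Rightarrow> com" where
  "set_var x e \<equiv> Assign x (Const 0) e"

text \<open>Subtraction is truncated, so the guard is nonzero exactly while \<open>i\<close> is
  below \<open>x\<close>, and its value is the number of iterations left.\<close>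

definition for_loop :: "string \<Rightarrow> string \<Rightarrow> com \<Rightarrow> com" where
  "for_loop i x c = Seq (set_var i (Const 0))
     (While (Monus (var x) (var i)) (Seq c (set_var i (Plus (var i) (Const 1)))))"

lemma assigned_for_loop [simp]: "assigned (for_loop i x c) = insert i (assigned c)"
  by (auto simp: for_loop_def)

text \<open>Requiring the guard to equal the number of remaining iterations gives termination and
  the bound \<open>K\<close> on the iterations at once.\<close>

lemma wp_While_count:
  fixes J :: "nat \<Rightarrow> store \<Rightarrow> bool"
  assumes "n \<le> K" and "k \<le> n" and "J k s"
    and guard: "\<And>j s'. j \<le> n \<Longrightarrow> J j s' \<Longrightarrow> val b s' = n - j"
    and body: "\<And>j s'. j < n \<Longrightarrow> J j s' \<Longrightarrow> wp K c (J (Suc j)) s'"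
  shows "wp K (While b c) (J n) s"
proof -
  let ?a = "(cost_rate b + width b + 1) * K"
  have test: "cost b s' + nat_size (val b s') \<le> ?a" if "bounded_store K s'" for s'
    using cost_le[OF that, of b] nat_size_val_le[OF that, of b] by (simp add: algebra_simps)
  \<comment> \<open>Induction on the number \<open>d\<close> of remaining iterations. The additional
    \<open>?a\<close> pays for the final failing test; it is covered by the factor
    \<open>Suc K\<close> in \<open>time_bound\<close>.\<close>
  have loop: "\<exists>t s'. exec (While b c) s t s' \<and> t \<le> d * (?a + time_bound c K) + ?a \<and>
      bounded_store K s' \<and> J n s'"
    if "bounded_store K s" "J (n - d) s" "d \<le> n" for d s
    using that
  proof (induction d arbitrary: s)
    case 0
    then have "val b s = 0" using guard[of n s] by simp
    from exec.WhileFalse[OF this, of c] test[OF 0(1)] 0 show ?case by fastforce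
  next
    case (Suc d)
    have v: "val b s \<noteq> 0" using guard[of "n - Suc d" s] Suc.prems by simp
    have "Suc (n - Suc d) = n - d" using Suc.prems by simp
    then obtain t s' where 1: "exec c s t s'" "t \<le> time_bound c K" "bounded_store K s'" "J (n - d) s'"
      using body[of "n - Suc d" s] Suc.prems unfolding wp_def by auto
    obtain t' s'' where 2: "exec (While b c) s' t' s''" "t' \<le> d * (?a + time_bound c K) + ?a"
      "bounded_store K s''" "J n s''"
      using Suc.IH[OF 1(3,4)] Suc.prems by auto
    show ?case
    proof (intro exI conjI)
      show "exec (While b c) s (cost b s + nat_size (val b s) + t + t') s''"
        by (rule exec.WhileTrue[OF v 1(1) 2(1)])
      show "cost b s + nat_size (val b s) + t + t' \<le> Suc d * (?a + time_bound c K) + ?a"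
        using test[OF Suc.prems(1)] 1(2) 2(2) by simp
    qed (use 2 in auto)
  qed
  have "(n - k) * (?a + time_bound c K) + ?a \<le> time_bound (While b c) K"
  proof -
    have "(n - k) * (?a + time_bound c K) \<le> K * (?a + time_bound c K)"
      using assms(1) by (intro mult_right_mono) auto
    then show ?thesis unfolding time_bound.simps mult_Suc by linarith
  qed
  then show ?thesis
    unfolding wp_def using loop[of s "n - k"] assms(2,3)
    by (metis (no_types, lifting) diff_diff_cancel diff_le_self le_trans)
qed

lemma wp_for_loop:
  fixes J :: "nat \<Rightarrow> store \<Rightarrow> bool"
  assumes sub: "assigned c \<subseteq> A"
    and fresh: "i \<noteq> x" "i \<notin> A" "x \<notin> A"
    and n: "s x 0 = n" "n \<le> K"
    and init: "J 0 (assign_store s i 0 0)"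
    and body: "\<And>k s'. \<lbrakk>k < n; \<And>y. y \<notin> insert i A \<Longrightarrow> s' y = s y; s' i 0 = k; J k s'\<rbrakk> \<Longrightarrow>
      wp K c (\<lambda>s''. J (Suc k) (assign_store s'' i 0 (Suc k))) s'"
  shows "wp K (for_loop i x c) (J n) s"
proof -
  \<comment> \<open>The frame and the value of the counter are invariants of every such loop; adding
    them here spares each \<open>J\<close> from repeating them.\<close>
  define J' where "J' k s' \<longleftrightarrow> (\<forall>y. y \<notin> insert i A \<longrightarrow> s' y = s y) \<and> s' i 0 = k \<and> J k s'"
    for k s'
  have Jx: "s' x 0 = n" if "J' k s'" for k s'
    using that n fresh by (auto simp: J'_def)
  have "wp K (While (Monus (var x) (var i)) (Seq c (set_var i (Plus (var i) (Const 1))))) (J' n)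
      (assign_store s i 0 0)"
  proof (rule wp_While_count[OF n(2), of 0])
    show "J' 0 (assign_store s i 0 0)" using init by (auto simp: J'_def assign_store_def)
    show "val (Monus (var x) (var i)) s' = n - j" if "J' j s'" for j s'
      using Jx[OF that] that by (simp add: J'_def)
    show "wp K (Seq c (set_var i (Plus (var i) (Const 1)))) (J' (Suc j)) s'"
      if j: "j < n" and J: "J' j s'" for j s'
    proof (rule wp_then[OF _ sub])
      show "wp K c (\<lambda>s''. J (Suc j) (assign_store s'' i 0 (Suc j))) s'"
        using body[OF j, of s'] J by (simp add: J'_def)
      fix s''
      assume fr: "\<And>y. y \<notin> A \<Longrightarrow> s'' y = s' y"
        and J2: "J (Suc j) (assign_store s'' i 0 (Suc j))"
      have i: "s'' i 0 = j" using fr[OF fresh(2)] J by (simp add: J'_def)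
      show "wp K (set_var i (Plus (var i) (Const 1))) (J' (Suc j)) s''"
      proof (rule wp_Assign)
        have "Suc j < 2 ^ K"
          using j n(2) less_exp[of K] by linarith
        then show "val (Plus (var i) (Const 1)) s'' < 2 ^ K" using i by simp
        show "J' (Suc j) (assign_store s'' i (val (Const 0) s'') (val (Plus (var i) (Const 1)) s''))"
          using i J J2 fr by (auto simp: J'_def assign_store_def)
      qed
    qed
  qed simp
  then have "wp K (While (Monus (var x) (var i)) (Seq c (set_var i (Plus (var i) (Const 1))))) (J n)
      (assign_store s i 0 0)"
    by (rule wp_conseq) (simp add: J'_def)
  then show ?thesis
    unfolding for_loop_def by (intro wp_Seq wp_Assign) simp_all
qed

text \<open>\<open>b\<close> and \<open>h\<close> are the same for all instances, so substituting
  input length plus \<open>b\<close> for \<open>K\<close> in the time bound again gives a polynomial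
  in the input length.\<close>

lemma poly_time_solvableI:
  assumes "\<And>I. I \<in> X \<Longrightarrow> bounded_store (list_size (enc I) + b) (input_store (enc I))"
    and "\<And>I. I \<in> X \<Longrightarrow> wp (list_size (enc I) + b) c
      (\<lambda>s. s ''outlen'' 0 \<le> h * list_size (enc I) \<and> sol I (output_of s)) (input_store (enc I))"
  shows "poly_time_solvable X enc sol"
proof -
  obtain p :: "nat poly" where p: "\<And>K. time_bound c K = poly p K"
    using time_bound_poly by blast
  show ?thesis
    unfolding poly_time_solvable_def
  proof (rule exI[of _ c], rule exI[of _ "p \<circ>\<^sub>p [:b, 1:] + [:0, h:]"], rule ballI)
    fix I assume I: "I \<in> X"
    let ?L = "list_size (enc I)"
    obtain t s where s: "exec c (input_store (enc I)) t s" "t \<le> time_bound c (?L + b)"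
      "s ''outlen'' 0 \<le> h * ?L" "sol I (output_of s)"
      using assms[OF I] unfolding wp_def by blast
    have "t + length (output_of s) \<le> poly (p \<circ>\<^sub>p [:b, 1:] + [:0, h:]) ?L"
      using s(2,3) by (simp add: p poly_pcompose output_of_def add.commute mult.commute)
    with s show "\<exists>t s. exec c (input_store (enc I)) t s \<and>
      t + length (output_of s) \<le> poly (p \<circ>\<^sub>p [:b, 1:] + [:0, h:]) ?L \<and> sol I (output_of s)"
      by blast
  qed
qed

section \<open>Optimal schemes with a unique rejectable state\<close>

locale single_reject =
  fixes I :: "('s, 'g) persuasion" and r :: 's
  assumes persuasion: "constrained_persuasion I"
    and rej_eq: "rej I = {r}"
begin

abbreviation q :: "'s \<Rightarrow> real" where
  "q \<theta> \<equiv> of_rat (prob I \<theta>)"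

text \<open>
  With \<open>z\<close> as the only signal that may be rejected, one unit of mass of an acceptable state
  contributes \<open>priority - 1\<close> to the utility: a signal available to \<open>r\<close> also carries a matching
  unit of \<open>r\<close>. A value of \<open>z\<close> that is not a signal stands for rejecting nothing.
\<close>

definition priority :: "'g \<Rightarrow> 's \<Rightarrow> 'g \<Rightarrow> nat" where
  "priority z a \<sigma> =
     (if (a, \<sigma>) \<in> edges I then if (r, \<sigma>) \<in> edges I then if \<sigma> = z then 1 else 3 else 2 else 0)"

text \<open>Priority 0 is reserved for non-edges. No state is isolated, so the maximum is always
  attained on an edge.\<close>

definition rank :: "'g \<Rightarrow> 's \<Rightarrow> nat" where
  "rank z a = Max (priority z a ` signals I)"

text \<open>The \<open>- 1\<close> undoes the shift that reserves 0 for non-edges; it does not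
  truncate, since ranks of states are positive.\<close>

definition gain :: "'g \<Rightarrow> real" where
  "gain z = (\<Sum>a\<in>acc I. q a * real (rank z a - 1))"

text \<open>The acceptable mass that can be used to cover \<open>r\<close>. If \<open>z\<close> is
  not a signal, it comes from all acceptable states that share a signal with
  \<open>r\<close>.\<close>

definition cover :: "'g \<Rightarrow> real" where
  "cover z = (\<Sum>a\<in>{a\<in>acc I. rank z a = 3}. q a)"

section \<open>Elementary facts about instances, ranks and sums over edges\<close>

lemma finite_states: "finite (acc I)" "finite (rej I)" "finite (states I)"
  and finite_signals: "finite (signals I)"
  and edges_subset: "edges I \<subseteq> states I \<times> signals I"
  and sum_q: "(\<Sum>\<theta>\<in>states I. q \<theta>) = 1"
  and q_pos: "\<theta> \<in> states I \<Longrightarrow> q \<theta> > 0"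
  using persuasion
  by (auto simp: constrained_persuasion_def states_def of_rat_sum[symmetric])

lemma states_eq: "states I = insert r (acc I)" and r_not_acc: "r \<notin> acc I"
  using persuasion rej_eq by (auto simp: constrained_persuasion_def states_def)

lemma nbs_state_subset: "nbs_state I \<theta> \<subseteq> signals I"
  using edges_subset by (auto simp: nbs_state_def)

lemma finite_nbs_state: "finite (nbs_state I \<theta>)"
  using nbs_state_subset finite_signals by (rule finite_subset)

lemma nbs_state_nonempty: "\<theta> \<in> states I \<Longrightarrow> nbs_state I \<theta> \<noteq> {}"
  using persuasion by (auto simp: constrained_persuasion_def)

lemma nbs_signal_subset: "nbs_signal I \<sigma> \<subseteq> states I"
  using edges_subset by (auto simp: nbs_signal_def)

lemma q_le_1: "\<theta> \<in> states I \<Longrightarrow> q \<theta> \<le> 1"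
  using member_le_sum[of \<theta> "states I" q] sum_q q_pos finite_states(3) by (simp add: less_imp_le)

lemma acc_in_states: "a \<in> acc I \<Longrightarrow> a \<in> states I"
  by (simp add: states_eq)

lemma priority_le_rank: "\<sigma> \<in> signals I \<Longrightarrow> priority z a \<sigma> \<le> rank z a"
  unfolding rank_def using finite_signals by (intro Max_ge) auto

lemma rank_attained: "a \<in> states I \<Longrightarrow> \<exists>\<sigma>\<in>signals I. rank z a = priority z a \<sigma>"
proof -
  assume "a \<in> states I"
  then have "signals I \<noteq> {}" using nbs_state_nonempty nbs_state_subset by blast
  then have "rank z a \<in> priority z a ` signals I"
    unfolding rank_def using finite_signals by (intro Max_in) auto
  then show ?thesis by auto
qed

lemma rank_bounds: "a \<in> states I \<Longrightarrow> 1 \<le> rank z a \<and> rank z a \<le> 3"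
proof
  assume a: "a \<in> states I"
  then obtain \<sigma> where \<sigma>: "(a, \<sigma>) \<in> edges I" using nbs_state_nonempty by (auto simp: nbs_state_def)
  then have "1 \<le> priority z a \<sigma>" by (simp add: priority_def)
  also have "\<dots> \<le> rank z a" using \<sigma> edges_subset by (intro priority_le_rank) auto
  finally show "1 \<le> rank z a" .
  obtain \<tau> where "rank z a = priority z a \<tau>" using rank_attained[OF a] by blast
  then show "rank z a \<le> 3" by (simp add: priority_def)
qed

text \<open>The value 0, 1 or 2 of a unit splits into the unit itself, if accepted, and the unit of
  \<open>r\<close> covered by it. In this form the utility of a greedy scheme can be compared with
  \<open>gain\<close>.\<close>

lemma gain_eq: "gain z = (\<Sum>a\<in>{a\<in>acc I. 2 \<le> rank z a}. q a) + cover z"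
proof -
  have "real (rank z a - 1) = of_bool (2 \<le> rank z a) + of_bool (rank z a = 3)" if "a \<in> acc I" for a
  proof -
    have "rank z a \<in> {1, 2, 3}" using rank_bounds[OF acc_in_states[OF that], of z] by auto
    then show ?thesis by auto
  qed
  then have "gain z = (\<Sum>a\<in>acc I. q a * of_bool (2 \<le> rank z a) + q a * of_bool (rank z a = 3))"
    unfolding gain_def by (intro sum.cong) (auto simp: distrib_left)
  also have "\<dots> = (\<Sum>a\<in>{a\<in>acc I. 2 \<le> rank z a}. q a) + cover z"
    unfolding cover_def sum.distrib sum.inter_filter[OF finite_states(1)]
    by (intro arg_cong2[where f = "(+)"] sum.cong) simp_all
  finally show ?thesis .
qed

text \<open>Singling out no signal can only turn a priority 1 into 3. This transfers a shortage of
  acceptable mass from a dummy \<open>z'\<close> to every actual \<open>z\<close>.\<close>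

lemma cover_mono: "z' \<notin> signals I \<Longrightarrow> cover z \<le> cover z'"
  unfolding cover_def
proof (rule sum_mono2)
  assume z': "z' \<notin> signals I"
  show "{a \<in> acc I. rank z a = 3} \<subseteq> {a \<in> acc I. rank z' a = 3}"
  proof clarify
    fix a assume a: "a \<in> acc I" "rank z a = 3"
    then obtain \<sigma> where \<sigma>: "\<sigma> \<in> signals I" "priority z a \<sigma> = 3"
      using rank_attained[OF acc_in_states, of a z] by auto
    then have "priority z' a \<sigma> = 3"
      using z' by (auto simp: priority_def split: if_splits)
    then have "3 \<le> rank z' a" using priority_le_rank[OF \<sigma>(1), of z' a] by simp
    then show "rank z' a = 3" using rank_bounds[OF acc_in_states[OF a(1)], of z'] by simp
  qed
qed (use finite_states q_pos acc_in_states in \<open>auto simp: less_imp_le\<close>)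

lemma rej_sum:
  fixes f :: "'s \<Rightarrow> real"
  shows "(\<Sum>\<theta>\<in>nbs_signal I \<sigma> \<inter> rej I. f \<theta>) = (if (r, \<sigma>) \<in> edges I then f r else 0)"
  by (simp add: rej_eq nbs_signal_def)

lemma nbs_signal_sum:
  fixes f :: "'s \<Rightarrow> real"
  shows "(\<Sum>\<theta>\<in>nbs_signal I \<sigma>. f \<theta>) =
    (\<Sum>\<theta>\<in>nbs_signal I \<sigma> \<inter> acc I. f \<theta>) + (if (r, \<sigma>) \<in> edges I then f r else 0)"
proof -
  have "nbs_signal I \<sigma> = (nbs_signal I \<sigma> \<inter> acc I) \<union> (nbs_signal I \<sigma> \<inter> rej I)"
    using nbs_signal_subset by (auto simp: states_def)
  moreover have "(nbs_signal I \<sigma> \<inter> acc I) \<inter> (nbs_signal I \<sigma> \<inter> rej I) = {}"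
    using rej_eq r_not_acc by auto
  ultimately have "sum f (nbs_signal I \<sigma>) =
      sum f (nbs_signal I \<sigma> \<inter> acc I) + sum f (nbs_signal I \<sigma> \<inter> rej I)"
    using sum.union_disjoint[of "nbs_signal I \<sigma> \<inter> acc I" "nbs_signal I \<sigma> \<inter> rej I" f]
      finite_states(1,2) by auto
  then show ?thesis by (simp only: rej_sum)
qed

text \<open>Double counting of edges: acceptance is a condition on signals, whereas masses are
  prescribed for states.\<close>

lemma sum_edges_swap:
  fixes f :: "'s \<Rightarrow> 'g \<Rightarrow> real"
  assumes "S \<subseteq> signals I"
  shows "(\<Sum>\<sigma>\<in>S. \<Sum>a\<in>nbs_signal I \<sigma> \<inter> acc I. f a \<sigma>) = (\<Sum>a\<in>acc I. \<Sum>\<sigma>\<in>nbs_state I a \<inter> S. f a \<sigma>)"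
proof -
  have fin: "finite S" using assms finite_signals by (rule finite_subset)
  have "(\<Sum>\<sigma>\<in>S. \<Sum>a\<in>nbs_signal I \<sigma> \<inter> acc I. f a \<sigma>) =
    (\<Sum>\<sigma>\<in>S. \<Sum>a\<in>{a\<in>acc I. (a, \<sigma>) \<in> edges I}. f a \<sigma>)"
    by (intro sum.cong refl) (auto simp: nbs_signal_def)
  also have "\<dots> = (\<Sum>a\<in>acc I. \<Sum>\<sigma>\<in>{\<sigma>\<in>S. (a, \<sigma>) \<in> edges I}. f a \<sigma>)"
    by (rule sum.swap_restrict[OF fin finite_states(1)])
  also have "\<dots> = (\<Sum>a\<in>acc I. \<Sum>\<sigma>\<in>nbs_state I a \<inter> S. f a \<sigma>)"
    by (intro sum.cong refl) (auto simp: nbs_state_def)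
  finally show ?thesis .
qed

lemma accept_signals_subset: "accept_signals I \<psi> \<subseteq> signals I"
  by (auto simp: accept_signals_def)

lemma finite_accept_signals: "finite (accept_signals I \<psi>)"
  using accept_signals_subset finite_signals by (rule finite_subset)

section \<open>Upper bounds on the utility\<close>

lemma utility_le_1:
  assumes "signaling_scheme I \<psi>"
  shows "sender_utility I \<psi> \<le> 1"
proof -
  have nn: "0 \<le> \<psi> (\<theta>, \<sigma>)" if "\<theta> \<in> nbs_signal I \<sigma>" for \<theta> \<sigma>
    using assms that by (auto simp: signaling_scheme_def nbs_signal_def)
  have "sender_utility I \<psi> \<le> (\<Sum>\<sigma>\<in>signals I. \<Sum>\<theta>\<in>nbs_signal I \<sigma>. \<psi> (\<theta>, \<sigma>))"
    unfolding sender_utility_def using accept_signals_subset finite_signals nn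
    by (intro sum_mono2 sum_nonneg) auto
  also have "\<dots> = (\<Sum>\<sigma>\<in>signals I. \<Sum>\<theta>\<in>{\<theta>\<in>states I. (\<theta>, \<sigma>) \<in> edges I}. \<psi> (\<theta>, \<sigma>))"
    using edges_subset by (intro sum.cong refl) (auto simp: nbs_signal_def)
  also have "\<dots> = (\<Sum>\<theta>\<in>states I. \<Sum>\<sigma>\<in>{\<sigma>\<in>signals I. (\<theta>, \<sigma>) \<in> edges I}. \<psi> (\<theta>, \<sigma>))"
    by (rule sum.swap_restrict[OF finite_signals finite_states(3)])
  also have "\<dots> = (\<Sum>\<theta>\<in>states I. \<Sum>\<sigma>\<in>nbs_state I \<theta>. \<psi> (\<theta>, \<sigma>))"
    using edges_subset by (intro sum.cong refl) (auto simp: nbs_state_def)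
  also have "\<dots> = 1"
    using assms sum_q by (simp add: signaling_scheme_def)
  finally show ?thesis .
qed

text \<open>If all signals of \<open>r\<close> were accepted, adding up the acceptance inequalities
  would bound \<open>q r\<close> by the acceptable mass on these signals. Only states of rank 3 can
  put mass there, so that mass is at most \<open>cover z\<close>.\<close>

lemma rejected_signal_exists:
  assumes \<psi>: "signaling_scheme I \<psi>" and z: "z \<notin> signals I" and less: "cover z < q r"
  shows "\<exists>\<sigma>\<in>nbs_state I r. \<sigma> \<notin> accept_signals I \<psi>"
proof (rule ccontr)
  assume "\<not> ?thesis"
  then have acc: "\<sigma> \<in> accept_signals I \<psi>" if "\<sigma> \<in> nbs_state I r" for \<sigma> using that by blast
  have nn: "0 \<le> \<psi> (\<theta>, \<sigma>)" if "\<sigma> \<in> nbs_state I \<theta>" for \<theta> \<sigma>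
    using \<psi> that by (auto simp: signaling_scheme_def nbs_state_def)
  have row: "(\<Sum>\<sigma>\<in>nbs_state I \<theta>. \<psi> (\<theta>, \<sigma>)) = q \<theta>" if "\<theta> \<in> states I" for \<theta>
    using \<psi> that by (auto simp: signaling_scheme_def)
  have "q r = (\<Sum>\<sigma>\<in>nbs_state I r. \<psi> (r, \<sigma>))"
    using row[of r] by (simp add: states_eq)
  also have "\<dots> \<le> (\<Sum>\<sigma>\<in>nbs_state I r. \<Sum>a\<in>nbs_signal I \<sigma> \<inter> acc I. \<psi> (a, \<sigma>))"
  proof (rule sum_mono)
    fix \<sigma> assume \<sigma>: "\<sigma> \<in> nbs_state I r"
    then show "\<psi> (r, \<sigma>) \<le> (\<Sum>a\<in>nbs_signal I \<sigma> \<inter> acc I. \<psi> (a, \<sigma>))"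
      using acc[OF \<sigma>] by (auto simp: accept_signals_def rej_sum nbs_state_def)
  qed
  also have "\<dots> = (\<Sum>a\<in>acc I. \<Sum>\<sigma>\<in>nbs_state I a \<inter> nbs_state I r. \<psi> (a, \<sigma>))"
    by (rule sum_edges_swap[OF nbs_state_subset])
  also have "\<dots> \<le> (\<Sum>a\<in>acc I. if rank z a = 3 then q a else 0)"
  proof (rule sum_mono)
    fix a assume a: "a \<in> acc I"
    show "(\<Sum>\<sigma>\<in>nbs_state I a \<inter> nbs_state I r. \<psi> (a, \<sigma>)) \<le> (if rank z a = 3 then q a else 0)"
    proof (cases "nbs_state I a \<inter> nbs_state I r = {}")
      case True
      then show ?thesis using q_pos[OF acc_in_states[OF a]] by simp
    next
      case False
      then obtain \<sigma> where \<sigma>: "(a, \<sigma>) \<in> edges I" "(r, \<sigma>) \<in> edges I" by (auto simp: nbs_state_def)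
      then have "\<sigma> \<in> signals I" using edges_subset by auto
      moreover from this have "priority z a \<sigma> = 3" using \<sigma> z by (auto simp: priority_def)
      ultimately have "rank z a = 3"
        using priority_le_rank[of \<sigma> z a] rank_bounds[OF acc_in_states[OF a], of z] by simp
      moreover have "(\<Sum>\<sigma>\<in>nbs_state I a \<inter> nbs_state I r. \<psi> (a, \<sigma>)) \<le> (\<Sum>\<sigma>\<in>nbs_state I a. \<psi> (a, \<sigma>))"
        using nn by (intro sum_mono2 finite_nbs_state) auto
      ultimately show ?thesis using row[OF acc_in_states[OF a]] by simp
    qed
  qed
  also have "\<dots> = cover z"
    unfolding cover_def using finite_states(1) by (simp add: sum.inter_filter)
  finally show False using less by simp
qed

text \<open>An accepted signal is worth at most twice its acceptable mass if \<open>r\<close> can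
  send it, and exactly that mass otherwise. Since it differs from \<open>z\<close>, this factor is
  the priority minus 1, which is at most the rank minus 1. The other signals of \<open>r\<close> may
  be rejected as well, so knowing a single rejected signal suffices.\<close>

lemma utility_le_gain:
  assumes \<psi>: "signaling_scheme I \<psi>" and z: "z \<in> nbs_state I r" "z \<notin> accept_signals I \<psi>"
  shows "sender_utility I \<psi> \<le> gain z"
proof -
  let ?A = "accept_signals I \<psi>"
  have nn: "0 \<le> \<psi> (\<theta>, \<sigma>)" if "\<sigma> \<in> nbs_state I \<theta>" for \<theta> \<sigma>
    using \<psi> that by (auto simp: signaling_scheme_def nbs_state_def)
  have "sender_utility I \<psi> \<le>
    (\<Sum>\<sigma>\<in>?A. \<Sum>a\<in>nbs_signal I \<sigma> \<inter> acc I. \<psi> (a, \<sigma>) * real (priority z a \<sigma> - 1))"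
    unfolding sender_utility_def
  proof (rule sum_mono)
    fix \<sigma> assume \<sigma>: "\<sigma> \<in> ?A"
    then have ne: "\<sigma> \<noteq> z" using z by auto
    let ?s = "\<Sum>a\<in>nbs_signal I \<sigma> \<inter> acc I. \<psi> (a, \<sigma>)"
    have "(\<Sum>\<theta>\<in>nbs_signal I \<sigma>. \<psi> (\<theta>, \<sigma>)) \<le> ?s * (if (r, \<sigma>) \<in> edges I then 2 else 1)"
      using \<sigma> nbs_signal_sum[of "\<lambda>\<theta>. \<psi> (\<theta>, \<sigma>)" \<sigma>]
      by (auto simp: accept_signals_def rej_sum split: if_splits)
    also have "\<dots> = (\<Sum>a\<in>nbs_signal I \<sigma> \<inter> acc I. \<psi> (a, \<sigma>) * real (priority z a \<sigma> - 1))"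
      using ne unfolding sum_distrib_right
      by (intro sum.cong refl) (auto simp: priority_def nbs_signal_def)
    finally show "(\<Sum>\<theta>\<in>nbs_signal I \<sigma>. \<psi> (\<theta>, \<sigma>)) \<le>
      (\<Sum>a\<in>nbs_signal I \<sigma> \<inter> acc I. \<psi> (a, \<sigma>) * real (priority z a \<sigma> - 1))" .
  qed
  also have "\<dots> = (\<Sum>a\<in>acc I. \<Sum>\<sigma>\<in>nbs_state I a \<inter> ?A. \<psi> (a, \<sigma>) * real (priority z a \<sigma> - 1))"
    by (rule sum_edges_swap[OF accept_signals_subset])
  also have "\<dots> \<le> gain z"
    unfolding gain_def
  proof (rule sum_mono)
    fix a assume a: "a \<in> acc I"
    have "(\<Sum>\<sigma>\<in>nbs_state I a \<inter> ?A. \<psi> (a, \<sigma>) * real (priority z a \<sigma> - 1)) \<le>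
      (\<Sum>\<sigma>\<in>nbs_state I a \<inter> ?A. \<psi> (a, \<sigma>) * real (rank z a - 1))"
      using nn nbs_state_subset
      by (intro sum_mono mult_left_mono) (auto intro!: diff_le_mono priority_le_rank)
    also have "\<dots> \<le> (\<Sum>\<sigma>\<in>nbs_state I a. \<psi> (a, \<sigma>) * real (rank z a - 1))"
      using nn by (intro sum_mono2 finite_nbs_state) auto
    also have "\<dots> = q a * real (rank z a - 1)"
      using \<psi> acc_in_states[OF a] by (simp add: sum_distrib_right[symmetric] signaling_scheme_def)
    finally show "(\<Sum>\<sigma>\<in>nbs_state I a \<inter> ?A. \<psi> (a, \<sigma>) * real (priority z a \<sigma> - 1)) \<le>
      q a * real (rank z a - 1)" .
  qed
  finally show ?thesis .
qed

section \<open>Greedy schemes and their optimality\<close>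

text \<open>
  Here \<open>f \<sigma>\<close> is the mass of \<open>r\<close> hidden behind the acceptable states of rank 3 that send \<open>\<sigma>\<close>;
  the rest \<open>d\<close> of the mass of \<open>r\<close> goes to \<open>z\<close>.
\<close>

definition greedy_scheme :: "'g \<Rightarrow> ('s \<Rightarrow> 'g) \<Rightarrow> ('g \<Rightarrow> real) \<Rightarrow> real \<Rightarrow> ('s \<times> 'g \<Rightarrow> real) \<Rightarrow> bool" where
  "greedy_scheme z T f d \<phi> \<longleftrightarrow>
     (\<forall>a\<in>acc I. T a \<in> signals I \<and> priority z a (T a) = rank z a) \<and>
     (\<forall>a\<in>acc I. \<forall>\<sigma>\<in>signals I. \<phi> (a, \<sigma>) = (if \<sigma> = T a then q a else 0)) \<and>
     (\<forall>\<sigma>\<in>signals I. \<phi> (r, \<sigma>) = f \<sigma> + (if \<sigma> = z then d else 0)) \<and>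
     (\<forall>\<sigma>\<in>signals I. 0 \<le> f \<sigma> \<and> f \<sigma> \<le> (\<Sum>a\<in>{a\<in>acc I. rank z a = 3 \<and> T a = \<sigma>}. q a)) \<and>
     (\<Sum>\<sigma>\<in>signals I. f \<sigma>) + d = q r \<and> d = max 0 (q r - cover z)"

lemma greedy_schemeD:
  assumes "greedy_scheme z T f d \<phi>"
  shows "a \<in> acc I \<Longrightarrow> T a \<in> signals I"
    and "a \<in> acc I \<Longrightarrow> priority z a (T a) = rank z a"
    and "a \<in> acc I \<Longrightarrow> \<sigma> \<in> signals I \<Longrightarrow> \<phi> (a, \<sigma>) = (if \<sigma> = T a then q a else 0)"
    and "\<sigma> \<in> signals I \<Longrightarrow> \<phi> (r, \<sigma>) = f \<sigma> + (if \<sigma> = z then d else 0)"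
    and "\<sigma> \<in> signals I \<Longrightarrow> 0 \<le> f \<sigma>"
    and "\<sigma> \<in> signals I \<Longrightarrow> f \<sigma> \<le> (\<Sum>a\<in>{a\<in>acc I. rank z a = 3 \<and> T a = \<sigma>}. q a)"
    and "(\<Sum>\<sigma>\<in>signals I. f \<sigma>) + d = q r"
    and "d = max 0 (q r - cover z)"
    and "0 \<le> d"
  using assms unfolding greedy_scheme_def by (blast, blast, blast, blast, blast, blast, blast, blast, simp)

text \<open>Priority 3 is impossible at such a signal, so no state of rank 3 is sent there and the
  upper bound on \<open>f\<close> is an empty sum.\<close>

lemma greedy_scheme_zero:
  assumes "greedy_scheme z T f d \<phi>" and "\<sigma> \<in> signals I" and "(r, \<sigma>) \<notin> edges I \<or> \<sigma> = z"
  shows "f \<sigma> = 0"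
proof -
  have "priority z a \<sigma> \<noteq> 3" for a using assms(3) by (auto simp: priority_def)
  then have none: "{a\<in>acc I. rank z a = 3 \<and> T a = \<sigma>} = {}"
    using greedy_schemeD(2)[OF assms(1)] by force
  show ?thesis
    using greedy_schemeD(5,6)[OF assms(1,2)] unfolding none by simp
qed

text \<open>The remainder \<open>d\<close> needs a place: either \<open>z\<close> is a signal of
  \<open>r\<close>, or \<open>d\<close> is 0 because \<open>cover z\<close> exhausts
  \<open>r\<close>. The bound by 1 on single entries follows from nonnegativity and the row
  sums.\<close>

lemma greedy_scheme_valid:
  assumes g: "greedy_scheme z T f d \<phi>"
    and z: "z \<in> nbs_state I r \<or> z \<notin> signals I \<and> q r \<le> cover z"
  shows "signaling_scheme I \<phi>"
proof -
  have dz: "d = 0" if "z \<notin> signals I"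
  proof -
    have "q r \<le> cover z" using z that nbs_state_subset by blast
    then show ?thesis using greedy_schemeD(8)[OF g] by simp
  qed
  have row: "(\<Sum>\<sigma>\<in>nbs_state I \<theta>. \<phi> (\<theta>, \<sigma>)) = q \<theta>" if \<theta>: "\<theta> \<in> states I" for \<theta>
  proof (cases "\<theta> = r")
    case True
    have "(\<Sum>\<sigma>\<in>nbs_state I r. \<phi> (r, \<sigma>)) = (\<Sum>\<sigma>\<in>nbs_state I r. f \<sigma> + (if \<sigma> = z then d else 0))"
      using nbs_state_subset by (intro sum.cong refl greedy_schemeD(4)[OF g]) blast
    also have "\<dots> = (\<Sum>\<sigma>\<in>signals I. f \<sigma>) + d"
    proof -
      have "(\<Sum>\<sigma>\<in>nbs_state I r. f \<sigma>) = (\<Sum>\<sigma>\<in>signals I. f \<sigma>)"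
        using greedy_scheme_zero[OF g] nbs_state_subset finite_signals
        by (intro sum.mono_neutral_left) (auto simp: nbs_state_def)
      moreover have "(\<Sum>\<sigma>\<in>nbs_state I r. if \<sigma> = z then d else 0) = d"
        using z dz finite_nbs_state nbs_state_subset by (auto simp: sum.delta)
      ultimately show ?thesis by (simp add: sum.distrib)
    qed
    finally show ?thesis using greedy_schemeD(7)[OF g] True by simp
  next
    case False
    then have a: "\<theta> \<in> acc I" using \<theta> states_eq by auto
    then have "priority z \<theta> (T \<theta>) \<noteq> 0"
      using greedy_schemeD(2)[OF g a] rank_bounds[OF \<theta>, of z] by simp
    then have "T \<theta> \<in> nbs_state I \<theta>" by (auto simp: priority_def nbs_state_def split: if_splits)
    moreover have "(\<Sum>\<sigma>\<in>nbs_state I \<theta>. \<phi> (\<theta>, \<sigma>)) = (\<Sum>\<sigma>\<in>nbs_state I \<theta>. if \<sigma> = T \<theta> then q \<theta> else 0)"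
      using nbs_state_subset by (intro sum.cong refl greedy_schemeD(3)[OF g a]) blast
    ultimately show ?thesis using finite_nbs_state by simp
  qed
  have nn: "0 \<le> \<phi> (\<theta>, \<sigma>)" if "(\<theta>, \<sigma>) \<in> edges I" for \<theta> \<sigma>
  proof -
    have "\<theta> = r \<or> \<theta> \<in> acc I" "\<sigma> \<in> signals I" using that edges_subset states_eq by auto
    then show ?thesis
      using greedy_schemeD(3,4,5,9)[OF g] q_pos[OF acc_in_states] by (auto simp: less_imp_le)
  qed
  have "\<phi> (\<theta>, \<sigma>) \<le> 1" if "(\<theta>, \<sigma>) \<in> edges I" for \<theta> \<sigma>
  proof -
    have \<theta>: "\<theta> \<in> states I" using that edges_subset by auto
    have "\<phi> (\<theta>, \<sigma>) \<le> (\<Sum>\<sigma>\<in>nbs_state I \<theta>. \<phi> (\<theta>, \<sigma>))"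
      using that nn finite_nbs_state by (intro member_le_sum) (auto simp: nbs_state_def)
    then show ?thesis using row[OF \<theta>] q_le_1[OF \<theta>] by linarith
  qed
  with nn row show ?thesis by (auto simp: signaling_scheme_def)
qed

text \<open>Only signals other than \<open>z\<close> are counted. All of them are accepted, since
  \<open>f\<close> is at most the acceptable mass sent to the same signal. As this is a lower bound,
  it does not matter whether \<open>z\<close> is accepted too.\<close>

lemma greedy_scheme_utility:
  assumes g: "greedy_scheme z T f d \<phi>"
    and z: "z \<in> nbs_state I r \<or> z \<notin> signals I \<and> q r \<le> cover z"
  shows "(\<Sum>a\<in>{a\<in>acc I. 2 \<le> rank z a}. q a) + (q r - d) \<le> sender_utility I \<phi>"
proof -
  let ?S = "signals I - {z}"
  have T: "T a \<in> signals I" "priority z a (T a) = rank z a" if "a \<in> acc I" for a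
    using greedy_schemeD(1,2)[OF g that] by auto
  have edge: "(a, T a) \<in> edges I" if "a \<in> acc I" for a
    using T[OF that] rank_bounds[OF acc_in_states[OF that], of z]
    by (auto simp: priority_def split: if_splits)
  have mass: "(\<Sum>\<theta>\<in>nbs_signal I \<sigma> \<inter> acc I. \<phi> (\<theta>, \<sigma>)) = (\<Sum>a\<in>{a\<in>acc I. T a = \<sigma>}. q a)"
    if "\<sigma> \<in> signals I" for \<sigma>
  proof (rule sum.mono_neutral_cong_right)
    show "finite (nbs_signal I \<sigma> \<inter> acc I)" using finite_states(1) by simp
    show "{a \<in> acc I. T a = \<sigma>} \<subseteq> nbs_signal I \<sigma> \<inter> acc I" using edge by (auto simp: nbs_signal_def)
  qed (use greedy_schemeD(3)[OF g _ that] in auto)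
  have rr: "\<phi> (r, \<sigma>) = f \<sigma>" if "\<sigma> \<in> ?S" for \<sigma>
    using greedy_schemeD(4)[OF g, of \<sigma>] that by auto
  have acc: "?S \<subseteq> accept_signals I \<phi>"
  proof
    fix \<sigma> assume \<sigma>: "\<sigma> \<in> ?S"
    have "f \<sigma> \<le> (\<Sum>a\<in>{a\<in>acc I. rank z a = 3 \<and> T a = \<sigma>}. q a)"
      using greedy_schemeD(6)[OF g] \<sigma> by blast
    also have "\<dots> \<le> (\<Sum>a\<in>{a\<in>acc I. T a = \<sigma>}. q a)"
      using finite_states(1) q_pos[OF acc_in_states] by (intro sum_mono2) (auto simp: less_imp_le)
    finally have "f \<sigma> \<le> (\<Sum>a\<in>{a\<in>acc I. T a = \<sigma>}. q a)" .
    moreover have "0 \<le> (\<Sum>a\<in>{a\<in>acc I. T a = \<sigma>}. q a)"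
      using q_pos[OF acc_in_states] by (intro sum_nonneg) (auto simp: less_imp_le)
    ultimately show "\<sigma> \<in> accept_signals I \<phi>"
      using \<sigma> rr[OF \<sigma>] mass[of \<sigma>] by (simp add: accept_signals_def rej_sum)
  qed
  have nn: "0 \<le> \<phi> (\<theta>, \<sigma>)" if "\<theta> \<in> nbs_signal I \<sigma>" for \<theta> \<sigma>
    using greedy_scheme_valid[OF g z] that by (auto simp: signaling_scheme_def nbs_signal_def)
  have "(\<Sum>a\<in>{a\<in>acc I. 2 \<le> rank z a}. q a) \<le> (\<Sum>a\<in>{a\<in>acc I. T a \<in> ?S}. q a)"
  proof (rule sum_mono2)
    show "{a \<in> acc I. 2 \<le> rank z a} \<subseteq> {a \<in> acc I. T a \<in> ?S}"
    proof clarify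
      fix a assume a: "a \<in> acc I" "2 \<le> rank z a"
      \<comment> \<open>If \<open>T a\<close> were \<open>z\<close>, then \<open>z\<close> would be
        a signal, hence one of \<open>r\<close>, and its priority would be at most 1.\<close>
      have "T a \<noteq> z"
      proof
        assume e: "T a = z"
        then have "(r, z) \<in> edges I" using z T(1)[OF a(1)] by (auto simp: nbs_state_def)
        then show False using T(2)[OF a(1)] a(2) e by (auto simp: priority_def split: if_splits)
      qed
      then show "T a \<in> ?S" using T(1)[OF a(1)] by auto
    qed
  qed (use finite_states(1) q_pos[OF acc_in_states] in \<open>auto simp: less_imp_le\<close>)
  also have "\<dots> = (\<Sum>\<sigma>\<in>?S. \<Sum>a\<in>{a\<in>acc I. T a = \<sigma>}. q a)"
  proof -
    have eq: "{a\<in>{a\<in>acc I. T a \<in> ?S}. T a = \<sigma>} = {a\<in>acc I. T a = \<sigma>}" if "\<sigma> \<in> ?S" for \<sigma>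
      using that by auto
    have "(\<Sum>a\<in>{a\<in>acc I. T a \<in> ?S}. q a) = (\<Sum>\<sigma>\<in>?S. \<Sum>a\<in>{a\<in>{a\<in>acc I. T a \<in> ?S}. T a = \<sigma>}. q a)"
      using finite_states(1) finite_signals by (intro sum.group[symmetric]) auto
    also have "\<dots> = (\<Sum>\<sigma>\<in>?S. \<Sum>a\<in>{a\<in>acc I. T a = \<sigma>}. q a)"
      using eq by (intro sum.cong refl) auto
    finally show ?thesis .
  qed
  finally have 1: "(\<Sum>a\<in>{a\<in>acc I. 2 \<le> rank z a}. q a) \<le> (\<Sum>\<sigma>\<in>?S. \<Sum>a\<in>{a\<in>acc I. T a = \<sigma>}. q a)" .
  \<comment> \<open>\<open>f\<close> vanishes at \<open>z\<close> and off the signals of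
    \<open>r\<close>, so its sum is the mass of \<open>r\<close> on the counted signals.\<close>
  have "q r - d = (\<Sum>\<sigma>\<in>signals I. f \<sigma>)"
    using greedy_schemeD(7)[OF g] by simp
  also have "\<dots> = (\<Sum>\<sigma>\<in>?S. if (r, \<sigma>) \<in> edges I then \<phi> (r, \<sigma>) else 0)"
    using greedy_scheme_zero[OF g] rr finite_signals by (intro sum.mono_neutral_cong_right) auto
  finally have "(\<Sum>a\<in>{a\<in>acc I. 2 \<le> rank z a}. q a) + (q r - d) \<le>
    (\<Sum>\<sigma>\<in>?S. (\<Sum>\<theta>\<in>nbs_signal I \<sigma>. \<phi> (\<theta>, \<sigma>)))"
    using 1 mass unfolding nbs_signal_sum sum.distrib by simp
  also have "\<dots> \<le> sender_utility I \<phi>"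
    unfolding sender_utility_def using acc accept_signals_subset finite_signals nn
    by (intro sum_mono2 sum_nonneg finite_accept_signals) auto
  finally show ?thesis .
qed

text \<open>With no signal singled out, priority 1 does not occur, every acceptable state has rank
  at least 2, and nothing of \<open>r\<close> remains. The lower bound on the utility becomes the
  total mass 1.\<close>

lemma greedy_scheme_optimal_hidden:
  assumes g: "greedy_scheme z T f d \<phi>" and z: "z \<notin> signals I" "q r \<le> cover z"
  shows "optimal_scheme I \<phi>"
proof -
  have "2 \<le> rank z a" if a: "a \<in> acc I" for a
  proof -
    obtain \<sigma> where \<sigma>: "(a, \<sigma>) \<in> edges I"
      using nbs_state_nonempty[OF acc_in_states[OF a]] by (auto simp: nbs_state_def)
    then have "\<sigma> \<in> signals I" using edges_subset by auto
    then show ?thesis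
      using priority_le_rank[of \<sigma> z a] z \<sigma> by (auto simp: priority_def split: if_splits)
  qed
  then have "{a\<in>acc I. 2 \<le> rank z a} = acc I" by auto
  moreover have "d = 0" using greedy_schemeD(8)[OF g] z by simp
  ultimately have "1 \<le> sender_utility I \<phi>"
    using greedy_scheme_utility[OF g] z sum_q finite_states(1) r_not_acc by (simp add: states_eq)
  then show ?thesis
    using greedy_scheme_valid[OF g] z utility_le_1 unfolding optimal_scheme_def by fastforce
qed

text \<open>The dummy \<open>w\<close> expresses the shortage of acceptable mass. It makes
  \<open>d\<close> equal to \<open>q r - cover z\<close> without truncation, so
  \<open>gain z\<close> is attained; any other scheme rejects some signal of \<open>r\<close> and is
  bounded by the gain of that signal.\<close>

lemma greedy_scheme_optimal_exposed:
  assumes g: "greedy_scheme z T f d \<phi>" and z: "z \<in> nbs_state I r"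
    and max: "\<And>z'. z' \<in> nbs_state I r \<Longrightarrow> gain z' \<le> gain z"
    and w: "w \<notin> signals I" "cover w < q r"
  shows "optimal_scheme I \<phi>"
proof -
  have "cover z < q r" using cover_mono[OF w(1), of z] w(2) by simp
  then have "gain z = (\<Sum>a\<in>{a\<in>acc I. 2 \<le> rank z a}. q a) + (q r - d)"
    using greedy_schemeD(8)[OF g] unfolding gain_eq by simp
  then have "gain z \<le> sender_utility I \<phi>"
    using greedy_scheme_utility[OF g] z by simp
  moreover have "sender_utility I \<psi> \<le> gain z" if \<psi>: "signaling_scheme I \<psi>" for \<psi>
    using rejected_signal_exists[OF \<psi> w] utility_le_gain[OF \<psi>] max by (meson order_trans)
  ultimately show ?thesis
    using greedy_scheme_valid[OF g] z unfolding optimal_scheme_def by fastforce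
qed

end

section \<open>Encoded instances\<close>

lemma length_concat_blocks:
  assumes "\<And>i. i < n \<Longrightarrow> length (g i) = k"
  shows "length (concat (map g [0..<n])) = n * k"
  using assms by (induction n) auto

lemma nth_concat_blocks:
  assumes "\<And>i. i < n \<Longrightarrow> length (g i) = k" and "i < n" and "j < k"
  shows "concat (map g [0..<n]) ! (i * k + j) = g i ! j"
  using assms
proof (induction n)
  case (Suc n)
  have len: "length (concat (map g [0..<n])) = n * k"
    using Suc.prems by (intro length_concat_blocks) simp
  show ?case
  proof (cases "i = n")
    case True
    then show ?thesis using len by (simp add: nth_append)
  next
    case False
    then have "i < n" using Suc.prems by simp
    then have "Suc i * k \<le> n * k" by (intro mult_right_mono) simp_all
    then have "i * k + j < n * k" using Suc.prems(3) by simp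
    then show ?thesis using Suc.IH Suc.prems \<open>i < n\<close> len by (simp add: nth_append)
  qed
qed simp

lemma row_index_less: "i < n \<Longrightarrow> j < k \<Longrightarrow> i * k + j < n * (k::nat)"
proof -
  assume "i < n" "j < k"
  then have "Suc i * k \<le> n * k" by (intro mult_right_mono) simp_all
  with \<open>j < k\<close> show ?thesis by simp
qed

lemma row_index_eq_iff:
  "j < k \<Longrightarrow> j' < k \<Longrightarrow> i * k + j = i' * k + j' \<longleftrightarrow> i = i' \<and> j = (j' :: nat)"
proof
  assume "j < k" "j' < k" and e: "i * k + j = i' * k + j'"
  from \<open>j < k\<close> \<open>j' < k\<close> have "(i * k + j) div k = i" "(i' * k + j') div k = i'" by simp_all
  with e have "i = i'" by metis
  with e show "i = i' \<and> j = j'" by simp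
qed simp

locale encoded_instance =
  fixes I :: "(nat, nat) persuasion"
  assumes persuasion: "constrained_persuasion I"
    and unique_rejects: "unique_rejects I"
    and numbered: "numbered I"
begin

definition r :: nat where "r = the_elem (rej I)"

sublocale single_reject I r
proof
  show "rej I = {r}"
  proof -
    obtain x where "rej I = {x}"
      using unique_rejects unfolding unique_rejects_def by (rule card_1_singletonE)
    then show ?thesis by (simp add: r_def)
  qed
qed (rule persuasion)

definition n :: nat where "n = card (states I)"
definition m :: nat where "m = card (signals I)"

lemma states_n: "states I = {..<n}" and signals_m: "signals I = {..<m}"
  using numbered by (auto simp: numbered_def n_def m_def)

lemma r_less: "r < n"
  using states_eq unfolding states_n by (metis insertI1 lessThan_iff)

lemma n_pos: "0 < n"
  using r_less by simp

lemma m_pos: "0 < m"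
proof -
  have "signals I \<noteq> {}"
    using nbs_state_nonempty[of r] nbs_state_subset[of r] by (simp add: states_eq) blast
  then show ?thesis by (cases m) (simp_all add: signals_m)
qed

lemma edges_less: "(a, \<sigma>) \<in> edges I \<Longrightarrow> a < n \<and> \<sigma> < m"
  using edges_subset states_n signals_m by auto

lemma acc_eq: "acc I = {..<n} - {r}"
  using states_eq r_not_acc states_n by auto

section \<open>Masses as integers over a common denominator\<close>

definition num :: "nat \<Rightarrow> nat" where "num a = nat (fst (quotient_of (prob I a)))"
definition den :: "nat \<Rightarrow> nat" where "den a = nat (snd (quotient_of (prob I a)))"

text \<open>A product can replace the least common multiple: its bit length is at most the sum of
  the lengths of the denominators, all of which are part of the input.\<close>

definition D :: nat where "D = (\<Prod>a<n. den a)"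
definition W :: "nat \<Rightarrow> nat" where "W a = num a * (D div den a)"

lemma den_pos: "0 < den a"
  using quotient_of_denom_pos'[of "prob I a"] by (simp add: den_def)

lemma D_pos: "0 < D"
  unfolding D_def using den_pos by (intro prod_pos) simp

lemma q_eq: "a < n \<Longrightarrow> q a = real (num a) / real (den a)"
proof -
  assume "a < n"
  then have "0 < prob I a" using persuasion states_n by (auto simp: constrained_persuasion_def)
  obtain x y where xy: "quotient_of (prob I a) = (x, y)" by fastforce
  then have e: "prob I a = of_int x / of_int y" and y: "0 < y"
    using quotient_of_div quotient_of_denom_pos by blast+
  then have "0 < x" using \<open>0 < prob I a\<close> by (simp add: zero_less_divide_iff)
  then show ?thesis using e y xy by (simp add: num_def den_def of_rat_divide)
qed

lemma W_eq: "a < n \<Longrightarrow> real (W a) = D * q a"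
proof -
  assume a: "a < n"
  then have "den a dvd D" unfolding D_def by (intro dvd_prodI) auto
  then have "real (D div den a) = real D / real (den a)" by (rule real_of_nat_div)
  then show ?thesis using q_eq[OF a] by (simp add: W_def)
qed

text \<open>The probabilities add up to 1. This is what bounds each scaled mass, and every partial
  sum of them, by \<open>D\<close>.\<close>

lemma sum_W: "(\<Sum>a<n. W a) = D"
proof -
  have "real (\<Sum>a<n. W a) = D * (\<Sum>a\<in>states I. q a)"
    using W_eq by (simp add: states_n sum_distrib_left)
  then show ?thesis by (simp only: sum_q mult_1_right of_nat_eq_iff)
qed

lemma W_le: "a < n \<Longrightarrow> W a \<le> D"
  using member_le_sum[of a "{..<n}" W] sum_W by simp

section \<open>Layout and length of the encoded instance\<close>

definition xs :: "nat list" where "xs = encode_instance I"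
definition L :: nat where "L = list_size xs"

lemma length_xs: "length xs = 2 + 3 * n + n * m"
  and xs_0: "xs ! 0 = n"
  and xs_1: "xs ! 1 = m"
  and xs_acc: "a < n \<Longrightarrow> xs ! (2 + 3 * a) = of_bool (a \<in> acc I)"
  and xs_num: "a < n \<Longrightarrow> xs ! (3 + 3 * a) = num a"
  and xs_den: "a < n \<Longrightarrow> xs ! (4 + 3 * a) = den a"
  and xs_edge: "a < n \<Longrightarrow> \<sigma> < m \<Longrightarrow> xs ! (2 + 3 * n + (a * m + \<sigma>)) = of_bool ((a, \<sigma>) \<in> edges I)"
proof -
  define g where "g = (\<lambda>a. [of_bool (a \<in> acc I), num a, den a])"
  define h where "h = (\<lambda>a. map (\<lambda>\<sigma>. of_bool ((a, \<sigma>) \<in> edges I) :: nat) [0..<m])"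
  let ?g = "concat (map g [0..<n])" and ?h = "concat (map h [0..<n])"
  have xs: "xs = n # m # ?g @ ?h"
    by (simp add: xs_def encode_instance_def Let_def g_def h_def n_def m_def num_def den_def)
  have lg: "length ?g = n * 3" by (rule length_concat_blocks) (simp add: g_def)
  have lh: "length ?h = n * m" by (rule length_concat_blocks) (simp add: h_def)
  show "length xs = 2 + 3 * n + n * m" using lg lh by (simp add: xs)
  show "xs ! 0 = n" "xs ! 1 = m" by (simp_all add: xs)
  have block: "xs ! (2 + (a * 3 + j)) = g a ! j" if "a < n" "j < 3" for a j
  proof -
    have "?g ! (a * 3 + j) = g a ! j"
      by (rule nth_concat_blocks) (use that in \<open>simp_all add: g_def\<close>)
    then show ?thesis
      using row_index_less[OF that] lg by (simp add: xs nth_append)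
  qed
  show "xs ! (2 + 3 * a) = of_bool (a \<in> acc I)" if "a < n"
    using block[OF that, of 0] by (simp add: g_def mult.commute)
  show "xs ! (3 + 3 * a) = num a" if "a < n"
    using block[OF that, of 1] by (simp add: g_def mult.commute eval_nat_numeral)
  show "xs ! (4 + 3 * a) = den a" if "a < n"
    using block[OF that, of 2] by (simp add: g_def mult.commute eval_nat_numeral)
  show "xs ! (2 + 3 * n + (a * m + \<sigma>)) = of_bool ((a, \<sigma>) \<in> edges I)" if "a < n" "\<sigma> < m"
  proof -
    have "?h ! (a * m + \<sigma>) = h a ! \<sigma>"
      by (rule nth_concat_blocks) (use that in \<open>simp_all add: h_def\<close>)
    then show ?thesis using lg that(2) by (simp add: xs nth_append h_def)
  qed
qed

lemma L_eq: "L = (\<Sum>k<length xs. nat_size (xs ! k))"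
  by (simp add: L_def list_size_def sum_list_sum_nth atLeast0LessThan)

lemma length_le_L: "length xs \<le> L"
proof -
  have "(\<Sum>k<length xs. 1) \<le> L" unfolding L_eq by (intro sum_mono) (simp add: nat_size_def)
  then show ?thesis by simp
qed

lemma nm_le_L: "n * m + 2 \<le> L" and n_le_L: "n \<le> L" and m_le_L: "m \<le> L"
proof -
  show "n * m + 2 \<le> L" "n \<le> L" using length_le_L length_xs by linarith+
  have "1 * m \<le> n * m" using n_pos by (intro mult_right_mono) simp_all
  then show "m \<le> L" using length_le_L length_xs by linarith
qed

text \<open>Each factor is below 2 to the power of its length, and the denominators occupy distinct
  positions \<open>4 + 3 * a\<close> of the input, so their lengths add up to at most
  \<open>L\<close>. Partial products are included because the program stores them.\<close>

lemma prod_den_le: "k \<le> n \<Longrightarrow> (\<Prod>a<k. den a) \<le> 2 ^ L"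
proof -
  assume k: "k \<le> n"
  have "(\<Prod>a<k. den a) \<le> (\<Prod>a<k. 2 ^ nat_size (den a))"
    using less_two_power_nat_size by (intro prod_mono) (simp add: less_imp_le)
  also have "\<dots> = 2 ^ (\<Sum>a<k. nat_size (den a))"
    by (simp add: power_sum)
  also have "\<dots> \<le> 2 ^ L"
  proof (rule power_increasing)
    have "(\<Sum>a<k. nat_size (den a)) = (\<Sum>a<k. nat_size (xs ! (4 + 3 * a)))"
      using k xs_den by (intro sum.cong) auto
    also have "\<dots> = (\<Sum>j\<in>(\<lambda>a. 4 + 3 * a) ` {..<k}. nat_size (xs ! j))"
      by (subst sum.reindex) (auto simp: inj_on_def)
    also have "\<dots> \<le> L"
      unfolding L_eq using k length_xs m_pos n_pos by (intro sum_mono2) auto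
    finally show "(\<Sum>a<k. nat_size (den a)) \<le> L" .
  qed simp
  finally show ?thesis .
qed

lemma D_le: "D \<le> 2 ^ L"
  unfolding D_def by (rule prod_den_le) simp

lemma input_bounded: "bounded_store (L + 3) (input_store xs)"
proof -
  have "xs ! k < 2 ^ (L + 3)" if "k < length xs" for k
  proof -
    have "nat_size (xs ! k) \<le> L"
      unfolding L_eq using that by (intro member_le_sum) auto
    then have "(2::nat) ^ nat_size (xs ! k) \<le> 2 ^ (L + 3)" by (intro power_increasing) simp_all
    then show ?thesis using less_two_power_nat_size[of "xs ! k"] by linarith
  qed
  moreover have "length xs < 2 ^ (L + 3)"
    using length_le_L less_exp[of "L + 3"] by linarith
  ultimately show ?thesis by (simp add: bounded_store_def input_store_def)
qed

text \<open>One sum for two purposes. With \<open>c = 1\<close> it is \<open>D\<close> times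
  \<open>gain z\<close>; with \<open>c = 2\<close> the truncated \<open>rank z a - 2\<close> is the
  indicator of rank 3, and the sum is \<open>D\<close> times \<open>cover z\<close>.\<close>

definition total :: "nat \<Rightarrow> nat \<Rightarrow> nat" where
  "total c z = (\<Sum>a<n. of_bool (a \<in> acc I) * W a * (rank z a - c))"

text \<open>Ranks are at most 3, so the last factor is at most 2, and the masses add up to
  \<open>D\<close>. Prefixes matter because each of them is stored by the summation loop.\<close>

lemma total_partial_le:
  assumes "k \<le> n" "1 \<le> c"
  shows "(\<Sum>a<k. of_bool (a \<in> acc I) * W a * (rank z a - c)) \<le> 2 * 2 ^ L"
proof -
  have "(\<Sum>a<k. of_bool (a \<in> acc I) * W a * (rank z a - c)) \<le> (\<Sum>a<k. W a * 2)"
  proof (rule sum_mono)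
    fix a assume "a \<in> {..<k}"
    then have "a \<in> states I" using assms(1) states_n by auto
    then have "rank z a - c \<le> 2" using rank_bounds[of a z] assms(2) by linarith
    then have "of_bool (a \<in> acc I) * W a \<le> W a" "rank z a - c \<le> 2" by (auto simp: of_bool_def)
    then show "of_bool (a \<in> acc I) * W a * (rank z a - c) \<le> W a * 2" by (rule mult_le_mono)
  qed
  also have "\<dots> \<le> (\<Sum>a<n. W a * 2)"
    using assms(1) by (intro sum_mono2) auto
  also have "\<dots> = 2 * D" by (simp add: sum_distrib_right[symmetric] sum_W)
  finally show ?thesis using D_le by linarith
qed

lemma total_le: "1 \<le> c \<Longrightarrow> total c z \<le> 2 * 2 ^ L"
  unfolding total_def by (rule total_partial_le) simp_all

lemma sum_of_bool_acc:
  fixes f :: "nat \<Rightarrow> 'a :: semiring_1"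
  shows "(\<Sum>a<n. of_bool (a \<in> acc I) * f a) = (\<Sum>a\<in>acc I. f a)"
proof -
  have "(\<Sum>a\<in>acc I. f a) = (\<Sum>a\<in>acc I. of_bool (a \<in> acc I) * f a)" by (intro sum.cong) simp_all
  also have "\<dots> = (\<Sum>a<n. of_bool (a \<in> acc I) * f a)"
    by (rule sum.mono_neutral_left) (auto simp: acc_eq)
  finally show ?thesis ..
qed

lemma total_gain: "real (total 1 z) = D * gain z"
proof -
  have "real (total 1 z) = (\<Sum>a<n. of_bool (a \<in> acc I) * (real (W a) * real (rank z a - 1)))"
    by (simp add: total_def mult.assoc)
  also have "\<dots> = D * gain z"
    unfolding sum_of_bool_acc gain_def sum_distrib_left
    by (intro sum.cong) (auto simp: W_eq acc_eq)
  finally show ?thesis .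
qed

lemma total_cover: "real (total 2 z) = D * cover z"
proof -
  have "real (total 2 z) = (\<Sum>a<n. of_bool (a \<in> acc I) * (real (W a) * real (rank z a - 2)))"
    by (simp add: total_def mult.assoc)
  also have "\<dots> = (\<Sum>a\<in>acc I. if rank z a = 3 then D * q a else 0)"
    unfolding sum_of_bool_acc
  proof (intro sum.cong refl)
    fix a assume a: "a \<in> acc I"
    then have "rank z a \<le> 3" using rank_bounds[OF acc_in_states] by blast
    then have "rank z a - 2 = of_bool (rank z a = 3)" by auto
    then show "real (W a) * real (rank z a - 2) = (if rank z a = 3 then D * q a else 0)"
      using a by (auto simp: W_eq acc_eq)
  qed
  also have "\<dots> = D * cover z"
    unfolding cover_def sum.inter_filter[OF finite_states(1)] sum_distrib_left
    by (intro sum.cong) simp_all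
  finally show ?thesis .
qed

section \<open>The integer table of a greedy scheme, filled state by state\<close>

definition high :: "nat \<Rightarrow> nat \<Rightarrow> nat set" where
  "high z k = {b. b < k \<and> b \<in> acc I \<and> rank z b = 3}"

lemma finite_high [simp]: "finite (high z k)"
  by (rule finite_subset[of _ "{..<k}"]) (auto simp: high_def)

lemma high_Suc: "high z (Suc k) = (if k \<in> acc I \<and> rank z k = 3 then insert k (high z k) else high z k)"
  by (auto simp: high_def less_Suc_eq)

lemma not_in_high: "k \<notin> high z k"
  by (simp add: high_def)

text \<open>
  State of the table \<open>X\<close> after the first \<open>k\<close> states have been treated, all entries being scaled by \<open>D\<close>;
  \<open>R\<close> is what is left of the mass of \<open>r\<close>.
\<close>

definition filled :: "nat \<Rightarrow> (nat \<Rightarrow> nat) \<Rightarrow> nat \<Rightarrow> (nat \<Rightarrow> nat \<Rightarrow> nat) \<Rightarrow> nat \<Rightarrow> bool" where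
  "filled z T k X R \<longleftrightarrow>
     (\<forall>b<n. b \<noteq> r \<longrightarrow> (\<forall>\<sigma><m. X b \<sigma> = (if b < k \<and> \<sigma> = T b then W b else 0))) \<and>
     (\<forall>\<sigma><m. X r \<sigma> \<le> (\<Sum>b\<in>{b\<in>high z k. T b = \<sigma>}. W b)) \<and>
     (\<Sum>\<sigma><m. X r \<sigma>) + R = W r \<and> R = W r - (\<Sum>b\<in>high z k. W b)"

text \<open>Used to bound cells in the row of \<open>r\<close> after an increase, which never
  exceeds the current \<open>R\<close>.\<close>

lemma filled_row_le:
  assumes "filled z T k X R" and "\<sigma> < m"
  shows "X r \<sigma> + R \<le> W r"
  using assms member_le_sum[of \<sigma> "{..<m}" "X r"] unfolding filled_def by fastforce

lemma filled_0: "(\<And>b \<sigma>. b < n \<Longrightarrow> \<sigma> < m \<Longrightarrow> X b \<sigma> = 0) \<Longrightarrow> filled z T 0 X (W r)"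
  using r_less by (simp add: filled_def high_def)

lemma filled_rej:
  assumes "filled z T k X R" "k < n" "k \<notin> acc I"
  shows "filled z T (Suc k) X R"
proof -
  have "k = r" using assms(2,3) acc_eq by auto
  then show ?thesis
    using assms(1,3) unfolding filled_def high_Suc by (auto simp: less_Suc_eq)
qed

lemma filled_low:
  assumes "filled z T k X R" "k \<in> acc I" "rank z k \<noteq> 3"
    and X': "\<And>b \<sigma>. b < n \<Longrightarrow> \<sigma> < m \<Longrightarrow> X' b \<sigma> = (if b = k \<and> \<sigma> = T k then W k else X b \<sigma>)"
  shows "filled z T (Suc k) X' R"
proof -
  have "X' r \<sigma> = X r \<sigma>" if "\<sigma> < m" for \<sigma>
    using X'[OF r_less that] assms(2) r_not_acc by auto
  then show ?thesis
    using assms(1,3) X' unfolding filled_def high_Suc by (auto simp: less_Suc_eq)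
qed

text \<open>\<open>R - (R - W k)\<close> is the minimum of \<open>R\<close> and \<open>W k\<close>,
  expressed with truncated subtraction: state \<open>k\<close> covers as much of the remaining mass
  of \<open>r\<close> as its own mass allows.\<close>

lemma filled_high:
  assumes F: "filled z T k X R" "k \<in> acc I" "rank z k = 3" "T k < m"
    and X': "\<And>b \<sigma>. b < n \<Longrightarrow> \<sigma> < m \<Longrightarrow> X' b \<sigma> = (if b = k \<and> \<sigma> = T k then W k
      else if b = r \<and> \<sigma> = T k then X r (T k) + (R - (R - W k)) else X b \<sigma>)"
  shows "filled z T (Suc k) X' (R - W k)"
proof -
  have kr: "k \<noteq> r" using F(2) r_not_acc by auto
  have row: "X' r \<sigma> = X r \<sigma> + (if \<sigma> = T k then R - (R - W k) else 0)" if "\<sigma> < m" for \<sigma>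
    using X'[OF r_less that] kr by auto
  have high: "high z (Suc k) = insert k (high z k)" using F by (simp add: high_Suc)
  have "X' b \<sigma> = (if b < Suc k \<and> \<sigma> = T b then W b else 0)" if "b < n" "b \<noteq> r" "\<sigma> < m" for b \<sigma>
    using X'[OF that(1,3)] that F(1) unfolding filled_def by (auto simp: less_Suc_eq)
  moreover have "X' r \<sigma> \<le> (\<Sum>b\<in>{b\<in>high z (Suc k). T b = \<sigma>}. W b)" if "\<sigma> < m" for \<sigma>
  proof -
    have le: "X r \<sigma> \<le> (\<Sum>b\<in>{b\<in>high z k. T b = \<sigma>}. W b)"
      using F(1) that unfolding filled_def by blast
    show ?thesis
    proof (cases "\<sigma> = T k")
      case True
      then have "{b\<in>high z (Suc k). T b = \<sigma>} = insert k {b\<in>high z k. T b = \<sigma>}" by (auto simp: high)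
      then have "(\<Sum>b\<in>{b\<in>high z (Suc k). T b = \<sigma>}. W b) = W k + (\<Sum>b\<in>{b\<in>high z k. T b = \<sigma>}. W b)"
        by (simp add: not_in_high)
      then show ?thesis using le row[OF that] True by simp
    next
      case False
      then have "{b\<in>high z (Suc k). T b = \<sigma>} = {b\<in>high z k. T b = \<sigma>}" by (auto simp: high)
      then show ?thesis using le row[OF that] False by simp
    qed
  qed
  moreover have "(\<Sum>\<sigma><m. X' r \<sigma>) + (R - W k) = W r"
  proof -
    have "(\<Sum>\<sigma><m. X' r \<sigma>) = (\<Sum>\<sigma><m. X r \<sigma> + (if \<sigma> = T k then R - (R - W k) else 0))"
      using row by (intro sum.cong) simp_all
    also have "\<dots> = (\<Sum>\<sigma><m. X r \<sigma>) + (R - (R - W k))"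
      using F(4) by (simp add: sum.distrib)
    finally show ?thesis using F(1) unfolding filled_def by linarith
  qed
  \<comment> \<open>Truncated subtractions compose: taking away the masses one by one or all
    together leaves the same remainder, also when it reaches 0.\<close>
  moreover have "R - W k = W r - (\<Sum>b\<in>high z (Suc k). W b)"
  proof -
    have "(\<Sum>b\<in>high z (Suc k). W b) = W k + (\<Sum>b\<in>high z k. W b)"
      unfolding high by (simp add: not_in_high)
    then show ?thesis using F(1) unfolding filled_def by linarith
  qed
  ultimately show ?thesis unfolding filled_def by blast
qed

text \<open>Division by \<open>D\<close> turns the table into a greedy scheme and the integer
  comparisons into those of \<open>cover\<close> and \<open>gain\<close>. The number
  \<open>m\<close>, the first one that is not a signal, serves as the dummy.\<close>

lemma filled_optimal:
  assumes F: "filled z T n X R"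
    and T: "\<And>a. a < n \<Longrightarrow> T a < m \<and> priority z a (T a) = rank z a"
    and z: "W r \<le> total 2 m \<and> z = m \<or>
      total 2 m < W r \<and> (r, z) \<in> edges I \<and> (\<forall>z'. (r, z') \<in> edges I \<longrightarrow> total 1 z' \<le> total 1 z)"
    and \<phi>: "\<And>a \<sigma>. a < n \<Longrightarrow> \<sigma> < m \<Longrightarrow>
      \<phi> (a, \<sigma>) = real (X a \<sigma> + (if a = r \<and> \<sigma> = z then R else 0)) / real D"
  shows "optimal_scheme I \<phi>"
proof -
  have D: "0 < real D" using D_pos by simp
  have q: "real (W a) / real D = q a" if "a < n" for a
    using W_eq[OF that] D by simp
  have high_n: "high z n = {a\<in>acc I. rank z a = 3}" by (auto simp: high_def acc_eq)
  have sum_q: "real (\<Sum>b\<in>B. W b) / real D = (\<Sum>b\<in>B. q b)" if "B \<subseteq> acc I" for B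
  proof -
    have "real (\<Sum>b\<in>B. W b) / real D = (\<Sum>b\<in>B. real (W b) / real D)"
      by (simp add: sum_divide_distrib)
    also have "\<dots> = (\<Sum>b\<in>B. q b)" using that acc_eq by (intro sum.cong refl q) auto
    finally show ?thesis .
  qed
  have cover: "real (\<Sum>b\<in>high z n. W b) / real D = cover z"
    unfolding cover_def high_n by (rule sum_q) auto
  have R: "real R / real D = max 0 (q r - cover z)"
  proof -
    have "real R = max 0 (real (W r) - real (\<Sum>b\<in>high z n. W b))"
      using F unfolding filled_def by linarith
    then have "real R / real D = max 0 (real (W r) / real D - real (\<Sum>b\<in>high z n. W b) / real D)"
      using D by (simp only: max_def diff_divide_distrib[symmetric] zero_le_divide_iff) auto
    then show ?thesis using q[OF r_less] cover by simp
  qed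
  \<comment> \<open>Here \<open>f\<close> is the row of \<open>r\<close> before the remainder is
    added, and \<open>d\<close> is that remainder, both scaled back.\<close>
  have "greedy_scheme z T (\<lambda>\<sigma>. real (X r \<sigma>) / real D) (real R / real D) \<phi>"
    unfolding greedy_scheme_def
  proof (intro conjI ballI)
    fix a assume a: "a \<in> acc I"
    then have an: "a < n" "a \<noteq> r" by (auto simp: acc_eq)
    show "T a \<in> signals I" "priority z a (T a) = rank z a" using T[OF an(1)] signals_m by auto
    fix \<sigma> assume "\<sigma> \<in> signals I"
    then have \<sigma>: "\<sigma> < m" by (simp add: signals_m)
    have "X a \<sigma> = (if \<sigma> = T a then W a else 0)"
      using F an \<sigma> unfolding filled_def by simp
    then show "\<phi> (a, \<sigma>) = (if \<sigma> = T a then q a else 0)"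
      using \<phi>[OF an(1) \<sigma>] an q[OF an(1)] by simp
  next
    fix \<sigma> assume "\<sigma> \<in> signals I"
    then have \<sigma>: "\<sigma> < m" by (simp add: signals_m)
    show "\<phi> (r, \<sigma>) = real (X r \<sigma>) / real D + (if \<sigma> = z then real R / real D else 0)"
      using \<phi>[OF r_less \<sigma>] by (simp add: add_divide_distrib)
    have "X r \<sigma> \<le> (\<Sum>b\<in>{b\<in>high z n. T b = \<sigma>}. W b)"
      using F \<sigma> unfolding filled_def by blast
    then have "real (X r \<sigma>) \<le> real (\<Sum>b\<in>{b\<in>high z n. T b = \<sigma>}. W b)"
      by (simp only: of_nat_le_iff)
    then have "real (X r \<sigma>) / real D \<le> real (\<Sum>b\<in>{b\<in>high z n. T b = \<sigma>}. W b) / real D"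
      by (rule divide_right_mono) simp
    also have "\<dots> = (\<Sum>b\<in>{b\<in>high z n. T b = \<sigma>}. q b)"
      by (rule sum_q) (auto simp: high_def)
    also have "{b\<in>high z n. T b = \<sigma>} = {a\<in>acc I. rank z a = 3 \<and> T a = \<sigma>}"
      by (auto simp: high_n)
    finally show "real (X r \<sigma>) / real D \<le> (\<Sum>a\<in>{a\<in>acc I. rank z a = 3 \<and> T a = \<sigma>}. q a)" .
  next
    have "(\<Sum>\<sigma><m. X r \<sigma>) + R = W r"
      using F unfolding filled_def by blast
    then have "real (\<Sum>\<sigma><m. X r \<sigma>) + real R = real (W r)"
      by (simp only: of_nat_add[symmetric])
    then have "real (\<Sum>\<sigma><m. X r \<sigma>) / real D + real R / real D = q r"
      using q[OF r_less] by (simp only: add_divide_distrib[symmetric])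
    then show "(\<Sum>\<sigma>\<in>signals I. real (X r \<sigma>) / real D) + real R / real D = q r"
      by (simp add: signals_m sum_divide_distrib)
  qed (use R in simp_all)
  note g = this
  have Wr: "real (W r) = D * q r" by (rule W_eq[OF r_less])
  have m: "m \<notin> signals I" by (simp add: signals_m)
  from z show ?thesis
  proof
    assume "W r \<le> total 2 m \<and> z = m"
    then have "z = m" and "real (W r) \<le> real (total 2 m)" by simp_all
    then have "q r \<le> cover z" unfolding Wr total_cover using D by simp
    then show ?thesis using greedy_scheme_optimal_hidden[OF g] m \<open>z = m\<close> by simp
  next
    assume z: "total 2 m < W r \<and> (r, z) \<in> edges I \<and> (\<forall>z'. (r, z') \<in> edges I \<longrightarrow> total 1 z' \<le> total 1 z)"
    show ?thesis
    proof (rule greedy_scheme_optimal_exposed[OF g _ _ m])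
      show "z \<in> nbs_state I r" using z by (simp add: nbs_state_def)
      have "real (total 2 m) < real (W r)" using z by simp
      then show "cover m < q r" unfolding Wr total_cover using D by simp
      show "gain z' \<le> gain z" if "z' \<in> nbs_state I r" for z'
      proof -
        have "real (total 1 z') \<le> real (total 1 z)" using z that by (simp add: nbs_state_def)
        then show ?thesis unfolding total_gain using D by simp
      qed
    qed
  qed
qed

end

section \<open>The program\<close>

lemma assign_store_apply [simp]:
  "assign_store s x i k y = (if y = x then (s x)(i := k) else s y)"
  by (simp add: assign_store_def)

definition acc_expr :: "expr \<Rightarrow> expr" where
  "acc_expr a = Cell ''in'' (Plus (Const 2) (Times (Const 3) a))"

definition num_expr :: "expr \<Rightarrow> expr" where
  "num_expr a = Cell ''in'' (Plus (Const 3) (Times (Const 3) a))"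

definition den_expr :: "expr \<Rightarrow> expr" where
  "den_expr a = Cell ''in'' (Plus (Const 4) (Times (Const 3) a))"

definition edge_expr :: "expr \<Rightarrow> expr \<Rightarrow> expr" where
  "edge_expr a \<sigma> = Cell ''in'' (Plus (Plus (Const 2) (Times (Const 3) (var ''n'')))
     (Plus (Times a (var ''m'')) \<sigma>))"

definition setup_prog :: com where
  "setup_prog =
     Seq (set_var ''n'' (Cell ''in'' (Const 0)))
    (Seq (set_var ''m'' (Cell ''in'' (Const 1)))
    (Seq (set_var ''D'' (Const 1))
    (Seq (for_loop ''i'' ''n'' (set_var ''D'' (Times (var ''D'') (den_expr (var ''i'')))))
    (for_loop ''i'' ''n''
      (Seq (Assign ''W'' (var ''i'') (Times (num_expr (var ''i'')) (Div (var ''D'') (den_expr (var ''i'')))))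
        (If (acc_expr (var ''i'')) Skip (set_var ''r'' (var ''i''))))))))"

text \<open>Truncated subtraction makes \<open>1 - \<bar>\<sigma> - z\<bar>\<close> a test for \<open>\<sigma> = z\<close>.\<close>

definition priority_expr :: "expr \<Rightarrow> expr \<Rightarrow> expr \<Rightarrow> expr" where
  "priority_expr z a \<sigma> =
     Times (edge_expr a \<sigma>)
       (Monus (Plus (Const 2) (edge_expr (var ''r'') \<sigma>))
         (Times (Times (Const 2) (edge_expr (var ''r'') \<sigma>))
           (Monus (Const 1) (Plus (Monus \<sigma> z) (Monus z \<sigma>)))))"

text \<open>The scan starts from 0, below the priority of any edge. Any maximizing signal will do;
  on ties the first one stays.\<close>

definition rank_prog :: com where
  "rank_prog =
     for_loop ''a'' ''n''
      (Seq (Assign ''rank'' (var ''a'') (Const 0))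
      (Seq (Assign ''tgt'' (var ''a'') (Const 0))
      (for_loop ''s'' ''m''
        (Seq (set_var ''p'' (priority_expr (var ''z'') (var ''a'') (var ''s'')))
        (If (Monus (var ''p'') (Cell ''rank'' (var ''a'')))
          (Seq (Assign ''rank'' (var ''a'') (var ''p'')) (Assign ''tgt'' (var ''a'') (var ''s'')))
          Skip)))))"

definition total_prog :: "nat \<Rightarrow> com" where
  "total_prog c =
     Seq (set_var ''g'' (Const 0))
    (for_loop ''a'' ''n''
      (set_var ''g'' (Plus (var ''g'') (Times (Times (acc_expr (var ''a'')) (Cell ''W'' (var ''a'')))
        (Monus (Cell ''rank'' (var ''a'')) (Const c))))))"

text \<open>\<open>best\<close> is the largest total plus one. Its initial value 0 thus means that
  no signal of \<open>r\<close> has been seen, and a signal whose total is 0 is still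
  recorded.\<close>

definition search_prog :: com where
  "search_prog =
     Seq (set_var ''best'' (Const 0))
    (Seq (set_var ''zb'' (Const 0))
    (for_loop ''z'' ''m''
      (If (edge_expr (var ''r'') (var ''z''))
        (Seq rank_prog (Seq (total_prog 1)
          (If (Monus (Plus (var ''g'') (Const 1)) (var ''best''))
            (Seq (set_var ''best'' (Plus (var ''g'') (Const 1))) (set_var ''zb'' (var ''z'')))
            Skip)))
        Skip)))"

text \<open>The test is nonzero exactly if \<open>W r\<close> is at most the total for the dummy
  \<open>m\<close>, that is, if \<open>r\<close> can be covered completely. Ranks and targets are
  recomputed at the end because \<open>z\<close> may have changed.\<close>

definition choose_prog :: com where
  "choose_prog =
     Seq (set_var ''z'' (var ''m''))
    (Seq rank_prog
    (Seq (total_prog 2)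
    (Seq (If (Monus (Plus (var ''g'') (Const 1)) (Cell ''W'' (var ''r''))) Skip (set_var ''z'' (var ''zb'')))
    rank_prog)))"

definition out_index :: "expr \<Rightarrow> expr \<Rightarrow> expr" where
  "out_index a \<sigma> = Times (Const 2) (Plus (Times a (var ''m'')) \<sigma>)"

definition clear_prog :: com where
  "clear_prog =
     Seq (set_var ''k'' (Times (var ''n'') (var ''m'')))
    (for_loop ''j'' ''k''
      (Seq (Assign ''out'' (Times (Const 2) (var ''j'')) (Const 0))
        (Assign ''out'' (Plus (Times (Const 2) (var ''j'')) (Const 1)) (var ''D''))))"

abbreviation hidden_index :: expr where
  "hidden_index \<equiv> out_index (var ''r'') (Cell ''tgt'' (var ''a''))"

definition fill_prog :: com where
  "fill_prog =
     Seq (set_var ''R'' (Cell ''W'' (var ''r'')))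
    (for_loop ''a'' ''n''
      (If (acc_expr (var ''a''))
        (Seq (Assign ''out'' (out_index (var ''a'') (Cell ''tgt'' (var ''a''))) (Cell ''W'' (var ''a'')))
        (If (Monus (Cell ''rank'' (var ''a'')) (Const 2))
          (Seq (Assign ''out'' hidden_index
              (Plus (Cell ''out'' hidden_index)
                (Monus (var ''R'') (Monus (var ''R'') (Cell ''W'' (var ''a''))))))
            (set_var ''R'' (Monus (var ''R'') (Cell ''W'' (var ''a'')))))
          Skip))
        Skip))"

text \<open>
  If \<open>z = m\<close> is no signal, the first assignment addresses a cell outside the row of \<open>r\<close>;
  it is harmless because then \<open>R = 0\<close>.
\<close>

definition finish_prog :: com where
  "finish_prog =
     Seq (Assign ''out'' (out_index (var ''r'') (var ''z''))
           (Plus (Cell ''out'' (out_index (var ''r'') (var ''z''))) (var ''R'')))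
    (set_var ''outlen'' (Times (Const 2) (var ''k'')))"

definition persuasion_prog :: com where
  "persuasion_prog =
     Seq setup_prog (Seq search_prog (Seq choose_prog (Seq clear_prog (Seq fill_prog finish_prog))))"

lemma assigned_progs [simp]:
  "assigned rank_prog = {''a'', ''rank'', ''tgt'', ''s'', ''p''}"
  "assigned (total_prog c) = {''g'', ''a''}"
  "assigned search_prog = {''best'', ''zb'', ''z'', ''a'', ''rank'', ''tgt'', ''s'', ''p'', ''g''}"
  "assigned choose_prog = {''z'', ''a'', ''rank'', ''tgt'', ''s'', ''p'', ''g''}"
  "assigned clear_prog = {''k'', ''j'', ''out''}"
  "assigned fill_prog = {''R'', ''a'', ''out''}"
  by (auto simp: rank_prog_def total_prog_def search_prog_def choose_prog_def clear_prog_def fill_prog_def)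

section \<open>Correctness of the program and bounds on the stored numbers\<close>

context encoded_instance
begin

text \<open>The three extra bits leave room for values up to \<open>7 * 2 ^ L\<close>; a total plus
  one, for instance, can be as large as \<open>2 * 2 ^ L + 1\<close>.\<close>

definition K :: nat where "K = L + 3"

lemma n_le_K: "n \<le> K" and m_le_K: "m \<le> K" and nm_le_K: "n * m \<le> K"
  using n_le_L m_le_L nm_le_L by (simp_all add: K_def)

lemma le_K_less_pow: "k \<le> K \<Longrightarrow> k < 2 ^ K"
  using less_exp[of K] by linarith

lemma less_pow_K:
  fixes k :: nat
  shows "k \<le> 7 * 2 ^ L \<Longrightarrow> k < 2 ^ K"
proof -
  have "(2::nat) ^ K = 8 * 2 ^ L" by (simp add: K_def power_add)
  moreover have "(0::nat) < 2 ^ L" by simp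
  ultimately show "k \<le> 7 * 2 ^ L \<Longrightarrow> k < 2 ^ K" by linarith
qed

lemma small_less_pow_K:
  fixes k :: nat
  shows "k \<le> 7 \<Longrightarrow> k < 2 ^ K"
proof (rule less_pow_K)
  have "(1::nat) \<le> 2 ^ L" by simp
  then show "k \<le> 7 \<Longrightarrow> k \<le> 7 * 2 ^ L" by linarith
qed

lemma bounded_storeD: "bounded_store K s \<Longrightarrow> s x i < 2 ^ K"
  by (simp add: bounded_store_def)

definition input_loaded :: "store \<Rightarrow> bool" where
  "input_loaded s \<longleftrightarrow> s ''in'' = (\<lambda>i. if i < length xs then xs ! i else 0)"

lemma val_input:
  assumes "input_loaded s" and "val e s = a" and "a < n"
  shows "val (acc_expr e) s = of_bool (a \<in> acc I)"
    and "val (num_expr e) s = num a"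
    and "val (den_expr e) s = den a"
proof -
  have "2 + 3 * a < length xs" "3 + 3 * a < length xs" "4 + 3 * a < length xs"
    using assms(3) by (simp_all add: length_xs)
  then show "val (acc_expr e) s = of_bool (a \<in> acc I)" "val (num_expr e) s = num a"
    "val (den_expr e) s = den a"
    using assms xs_acc[of a] xs_num[of a] xs_den[of a]
    by (simp_all add: acc_expr_def num_expr_def den_expr_def input_loaded_def)
qed

definition ready :: "store \<Rightarrow> bool" where
  "ready s \<longleftrightarrow> input_loaded s \<and> s ''n'' 0 = n \<and> s ''m'' 0 = m \<and> s ''r'' 0 = r \<and> s ''D'' 0 = D \<and>
     (\<forall>a<n. s ''W'' a = W a)"

lemma ready_cong:
  assumes "ready s" and "s' ''in'' = s ''in''" "s' ''n'' = s ''n''" "s' ''m'' = s ''m''"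
    "s' ''r'' = s ''r''" "s' ''D'' = s ''D''" "s' ''W'' = s ''W''"
  shows "ready s'"
  using assms by (simp add: ready_def input_loaded_def)

lemma readyD:
  assumes "ready s"
  shows "input_loaded s" "s ''n'' 0 = n" "s ''m'' 0 = m" "s ''r'' 0 = r" "s ''D'' 0 = D"
    "a < n \<Longrightarrow> s ''W'' a = W a"
  using assms by (simp_all add: ready_def)

lemma val_edge:
  assumes "ready s" and "val e s = a" "a < n" and "val f s = \<sigma>" "\<sigma> < m"
  shows "val (edge_expr e f) s = of_bool ((a, \<sigma>) \<in> edges I)"
proof -
  have "2 + 3 * n + (a * m + \<sigma>) < length xs"
    using row_index_less[OF assms(3,5)] by (simp add: length_xs)
  then show ?thesis
    using assms xs_edge[of a \<sigma>] by (simp add: edge_expr_def ready_def input_loaded_def)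
qed

text \<open>For an edge of \<open>a\<close>, the truncated difference is 2 off the signals of
  \<open>r\<close>, 3 on them, and 3 - 2 = 1 if such a signal is \<open>z\<close>; the leading edge
  bit turns non-edges into 0.\<close>

lemma val_priority:
  assumes "ready s" and "val e s = a" "a < n" and "val f s = \<sigma>" "\<sigma> < m" and "val h s = z"
  shows "val (priority_expr h e f) s = priority z a \<sigma>"
proof -
  have "val (var ''r'') s = r" using readyD[OF assms(1)] by simp
  from val_edge[OF assms(1) this r_less assms(4,5)] val_edge[OF assms(1-5)] show ?thesis
    using assms by (auto simp: priority_expr_def priority_def)
qed

lemma setup_spec:
  assumes in_s: "input_loaded s"
  shows "wp K setup_prog ready s"
  unfolding setup_prog_def
proof (rule wp_then[where A = "{''n''}" and P = "\<lambda>s'. s' ''n'' 0 = n"])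
  show "wp K (set_var ''n'' (Cell ''in'' (Const 0))) (\<lambda>s'. s' ''n'' 0 = n) s"
    using in_s length_xs xs_0 le_K_less_pow[OF n_le_K]
    by (intro wp_Assign) (simp_all add: input_loaded_def)
  fix s1 assume 1: "\<And>x. x \<notin> {''n''} \<Longrightarrow> s1 x = s x" "s1 ''n'' 0 = n"
  have in_1: "input_loaded s1" using in_s 1 by (simp add: input_loaded_def)
  let ?d = "set_var ''D'' (Times (var ''D'') (den_expr (var ''i'')))"
  let ?w = "Seq (Assign ''W'' (var ''i'') (Times (num_expr (var ''i'')) (Div (var ''D'') (den_expr (var ''i'')))))
    (If (acc_expr (var ''i'')) Skip (set_var ''r'' (var ''i'')))"
  show "wp K (Seq (set_var ''m'' (Cell ''in'' (Const 1)))
    (Seq (set_var ''D'' (Const 1)) (Seq (for_loop ''i'' ''n'' ?d) (for_loop ''i'' ''n'' ?w)))) ready s1"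
  proof (rule wp_then[where A = "{''m''}" and P = "\<lambda>s'. s' ''m'' 0 = m"])
    show "wp K (set_var ''m'' (Cell ''in'' (Const 1))) (\<lambda>s'. s' ''m'' 0 = m) s1"
      using in_1 length_xs xs_1 le_K_less_pow[OF m_le_K]
      by (intro wp_Assign) (simp_all add: input_loaded_def)
    fix s2 assume 2: "\<And>x. x \<notin> {''m''} \<Longrightarrow> s2 x = s1 x" "s2 ''m'' 0 = m"
    show "wp K (Seq (set_var ''D'' (Const 1)) (Seq (for_loop ''i'' ''n'' ?d) (for_loop ''i'' ''n'' ?w))) ready s2"
    proof (rule wp_then[where A = "{''D''}" and P = "\<lambda>s'. s' ''D'' 0 = 1"])
      show "wp K (set_var ''D'' (Const 1)) (\<lambda>s'. s' ''D'' 0 = 1) s2"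
        using small_less_pow_K[of 1] by (intro wp_Assign) simp_all
      fix s3 assume 3: "\<And>x. x \<notin> {''D''} \<Longrightarrow> s3 x = s2 x" "s3 ''D'' 0 = 1"
      show "wp K (Seq (for_loop ''i'' ''n'' ?d) (for_loop ''i'' ''n'' ?w)) ready s3"
      proof (rule wp_then[where A = "{''i'', ''D''}"])
        show "wp K (for_loop ''i'' ''n'' ?d) (\<lambda>s'. s' ''D'' 0 = (\<Prod>a<n. den a)) s3"
        proof (rule wp_for_loop[where A = "{''D''}" and J = "\<lambda>k s'. s' ''D'' 0 = (\<Prod>a<k. den a)"])
          fix k s' assume k: "k < n" and fr: "\<And>y. y \<notin> {''i'', ''D''} \<Longrightarrow> s' y = s3 y"
            and i: "s' ''i'' 0 = k" and J: "s' ''D'' 0 = (\<Prod>a<k. den a)"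
          have "input_loaded s'" using in_1 2 3 fr by (simp add: input_loaded_def)
          then have d: "val (den_expr (var ''i'')) s' = den k"
            using val_input(3)[of s' "var ''i''" k] i k by simp
          have "(\<Prod>a<Suc k. den a) \<le> 2 ^ L" using k by (intro prod_den_le) simp
          then have "val (Times (var ''D'') (den_expr (var ''i''))) s' < 2 ^ K"
            using J d by (intro less_pow_K) simp
          then show "wp K ?d (\<lambda>s''. assign_store s'' ''i'' 0 (Suc k) ''D'' 0 = (\<Prod>a<Suc k. den a)) s'"
            using J d by (intro wp_Assign) simp_all
        qed (use n_le_K 1 2 3 in simp_all)
        fix s4 assume 4: "\<And>x. x \<notin> {''i'', ''D''} \<Longrightarrow> s4 x = s3 x" "s4 ''D'' 0 = (\<Prod>a<n. den a)"
        have s4: "input_loaded s4" "s4 ''n'' 0 = n" "s4 ''m'' 0 = m" "s4 ''D'' 0 = D"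
          using in_1 1 2 3 4 by (simp_all add: input_loaded_def D_def)
        \<comment> \<open>The variable for \<open>r\<close> is set only when the loop passes that
          state, so the invariant speaks of it only for \<open>r < k\<close>. All other states are
          acceptable and leave it alone.\<close>
        have "wp K (for_loop ''i'' ''n'' ?w) (\<lambda>s'. (\<forall>a<n. s' ''W'' a = W a) \<and> (r < n \<longrightarrow> s' ''r'' 0 = r)) s4"
        proof (rule wp_for_loop[where A = "{''W'', ''r''}" and
            J = "\<lambda>k s'. (\<forall>a<k. s' ''W'' a = W a) \<and> (r < k \<longrightarrow> s' ''r'' 0 = r)"])
          fix k s' assume k: "k < n" and fr: "\<And>y. y \<notin> {''i'', ''W'', ''r''} \<Longrightarrow> s' y = s4 y"
            and i: "s' ''i'' 0 = k" and J: "(\<forall>a<k. s' ''W'' a = W a) \<and> (r < k \<longrightarrow> s' ''r'' 0 = r)"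
          have in': "input_loaded s'" using s4 fr by (simp add: input_loaded_def)
          have v: "val (Times (num_expr (var ''i'')) (Div (var ''D'') (den_expr (var ''i'')))) s' = W k"
            using val_input(2,3)[OF in', of "var ''i''" k] i k s4 fr by (simp add: W_def)
          show "wp K ?w (\<lambda>s''. (\<forall>a<Suc k. assign_store s'' ''i'' 0 (Suc k) ''W'' a = W a) \<and>
            (r < Suc k \<longrightarrow> assign_store s'' ''i'' 0 (Suc k) ''r'' 0 = r)) s'"
          proof (rule wp_then[where A = "{''W''}" and P = "\<lambda>s'. \<forall>a<Suc k. s' ''W'' a = W a"])
            have "W k < 2 ^ K" using W_le[OF k] D_le by (intro less_pow_K) simp
            then show "wp K (Assign ''W'' (var ''i'') (Times (num_expr (var ''i'')) (Div (var ''D'') (den_expr (var ''i'')))))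
              (\<lambda>s'. \<forall>a<Suc k. s' ''W'' a = W a) s'"
              using v i J by (intro wp_Assign) (simp_all add: less_Suc_eq)
            fix s5 assume 5: "\<And>x. x \<notin> {''W''} \<Longrightarrow> s5 x = s' x" "\<forall>a<Suc k. s5 ''W'' a = W a"
            have "input_loaded s5" "s5 ''i'' 0 = k" using in' 5 i by (simp_all add: input_loaded_def)
            then have "val (acc_expr (var ''i'')) s5 = of_bool (k \<in> acc I)"
              using val_input(1)[of s5 "var ''i''" k] k by simp
            then show "wp K (If (acc_expr (var ''i'')) Skip (set_var ''r'' (var ''i'')))
               (\<lambda>s''. (\<forall>a<Suc k. assign_store s'' ''i'' 0 (Suc k) ''W'' a = W a) \<and>
                 (r < Suc k \<longrightarrow> assign_store s'' ''i'' 0 (Suc k) ''r'' 0 = r)) s5"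
              using 5 J \<open>s5 ''i'' 0 = k\<close> k le_K_less_pow[of k] n_le_K
              by (intro wp_If wp_Skip wp_Assign) (auto simp: acc_eq less_Suc_eq)
          qed simp
        qed (use n_le_K s4 in simp_all)
        then show "wp K (for_loop ''i'' ''n'' ?w) ready s4"
          by (rule wp_conseq) (use s4 r_less in \<open>simp add: ready_def input_loaded_def\<close>)
      qed simp
    qed simp
  qed simp
qed simp

section \<open>Ranks, totals and the choice of \<open>z\<close>\<close>

definition ranked :: "nat \<Rightarrow> nat \<Rightarrow> store \<Rightarrow> bool" where
  "ranked z k s \<longleftrightarrow>
     (\<forall>a<k. s ''rank'' a = rank z a \<and> s ''tgt'' a < m \<and> priority z a (s ''tgt'' a) = rank z a)"

lemma rank_eqI:
  assumes "\<And>\<sigma>. \<sigma> < m \<Longrightarrow> priority z a \<sigma> \<le> k" and "\<tau> < m" "priority z a \<tau> = k"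
  shows "rank z a = k"
  unfolding rank_def signals_m using assms by (intro Max_eqI) auto

lemma priority_le_3: "priority z a \<sigma> \<le> 3"
  by (simp add: priority_def)

lemma rank_spec:
  assumes ready: "ready s" and z: "s ''z'' 0 = z"
  shows "wp K rank_prog (ranked z n) s"
  unfolding rank_prog_def
proof (rule wp_for_loop[where A = "{''rank'', ''tgt'', ''s'', ''p''}" and J = "ranked z"])
  fix a s1
  assume a: "a < n" and fr1: "\<And>y. y \<notin> {''a'', ''rank'', ''tgt'', ''s'', ''p''} \<Longrightarrow> s1 y = s y"
    and a1: "s1 ''a'' 0 = a" and J1: "ranked z a s1"
  let ?p = "set_var ''p'' (priority_expr (var ''z'') (var ''a'') (var ''s''))"
  let ?u = "If (Monus (var ''p'') (Cell ''rank'' (var ''a'')))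
    (Seq (Assign ''rank'' (var ''a'') (var ''p'')) (Assign ''tgt'' (var ''a'') (var ''s''))) Skip"
  have "wp K (Seq (Assign ''rank'' (var ''a'') (Const 0)) (Seq (Assign ''tgt'' (var ''a'') (Const 0))
      (for_loop ''s'' ''m'' (Seq ?p ?u)))) (\<lambda>s'. s' ''a'' 0 = a \<and> ranked z (Suc a) s') s1"
  proof (rule wp_then[where A = "{''rank''}" and P = "\<lambda>s'. ranked z a s' \<and> s' ''rank'' a = 0"])
    show "wp K (Assign ''rank'' (var ''a'') (Const 0)) (\<lambda>s'. ranked z a s' \<and> s' ''rank'' a = 0) s1"
      using J1 a1 by (intro wp_Assign) (simp_all add: ranked_def)
    fix s2 assume 2: "\<And>x. x \<notin> {''rank''} \<Longrightarrow> s2 x = s1 x" "ranked z a s2 \<and> s2 ''rank'' a = 0"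
    show "wp K (Seq (Assign ''tgt'' (var ''a'') (Const 0)) (for_loop ''s'' ''m'' (Seq ?p ?u)))
      (\<lambda>s'. s' ''a'' 0 = a \<and> ranked z (Suc a) s') s2"
    proof (rule wp_then[where A = "{''tgt''}" and
          P = "\<lambda>s'. ranked z a s' \<and> s' ''tgt'' a = 0"])
      show "wp K (Assign ''tgt'' (var ''a'') (Const 0)) (\<lambda>s'. ranked z a s' \<and> s' ''tgt'' a = 0) s2"
        using 2 a1 by (intro wp_Assign) (simp_all add: ranked_def)
      fix s3 assume 3: "\<And>x. x \<notin> {''tgt''} \<Longrightarrow> s3 x = s2 x" "ranked z a s3 \<and> s3 ''tgt'' a = 0"
      have ready3: "ready s3" by (rule ready_cong[OF ready]) (use fr1 2 3 in simp_all)
      have s3: "s3 ''z'' 0 = z" "s3 ''a'' 0 = a" "s3 ''rank'' a = 0" using fr1 2 3 z a1 by simp_all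
      \<comment> \<open>Before any edge has been met the target is a mere default, whose priority
        may differ from the recorded 0; hence the disjunction.\<close>
      define J where "J k s' \<longleftrightarrow> ranked z a s' \<and> (\<forall>\<sigma><k. priority z a \<sigma> \<le> s' ''rank'' a) \<and>
        (s' ''rank'' a = 0 \<and> s' ''tgt'' a = 0 \<or>
         s' ''tgt'' a < m \<and> priority z a (s' ''tgt'' a) = s' ''rank'' a)" for k s'
      have "wp K (for_loop ''s'' ''m'' (Seq ?p ?u)) (J m) s3"
      proof (rule wp_for_loop[where A = "{''rank'', ''tgt'', ''p''}"])
        show "J 0 (assign_store s3 ''s'' 0 0)" using 3 s3 by (simp add: J_def ranked_def)
        fix k s4
        assume k: "k < m" and fr4: "\<And>y. y \<notin> {''s'', ''rank'', ''tgt'', ''p''} \<Longrightarrow> s4 y = s3 y"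
          and s4: "s4 ''s'' 0 = k" and J4: "J k s4"
        have ready4: "ready s4" by (rule ready_cong[OF ready3]) (use fr4 in simp_all)
        have za: "s4 ''z'' 0 = z" "s4 ''a'' 0 = a" using fr4 s3 by simp_all
        have p: "val (priority_expr (var ''z'') (var ''a'') (var ''s'')) s4 = priority z a k"
          by (rule val_priority[OF ready4 _ a _ k]) (use za s4 in simp_all)
        show "wp K (Seq ?p ?u) (\<lambda>s'. J (Suc k) (assign_store s' ''s'' 0 (Suc k))) s4"
        proof (rule wp_then[where A = "{''p''}" and P = "\<lambda>s'. s' ''p'' 0 = priority z a k"])
          show "wp K ?p (\<lambda>s'. s' ''p'' 0 = priority z a k) s4"
            using p priority_le_3[of z a k] by (intro wp_Assign) (simp_all add: small_less_pow_K)
          fix s5 assume 5: "\<And>x. x \<notin> {''p''} \<Longrightarrow> s5 x = s4 x" "s5 ''p'' 0 = priority z a k"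
          have v: "val (Monus (var ''p'') (Cell ''rank'' (var ''a''))) s5 = priority z a k - s4 ''rank'' a"
            using 5 za by simp
          show "wp K ?u (\<lambda>s'. J (Suc k) (assign_store s' ''s'' 0 (Suc k))) s5"
          proof (rule wp_If, goal_cases)
            case 1
            have gt: "s4 ''rank'' a < priority z a k" using 1 v by simp
            have le: "priority z a \<sigma> \<le> priority z a k" if "\<sigma> < Suc k" for \<sigma>
            proof (cases "\<sigma> = k")
              case False
              then have "priority z a \<sigma> \<le> s4 ''rank'' a" using J4 that unfolding J_def by simp
              then show ?thesis using gt by linarith
            qed simp
            have rk: "ranked z a s4" using J4 unfolding J_def by simp
            have "wp K (Assign ''rank'' (var ''a'') (var ''p'')) (\<lambda>s'. s' ''rank'' = (s4 ''rank'')(a := priority z a k)) s5"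
              using 5 za small_less_pow_K[of "priority z a k"] priority_le_3[of z a k]
              by (intro wp_Assign) simp_all
            then show ?case
            proof (rule wp_then[where A = "{''rank''}"])
              fix s6
              assume 6: "\<And>x. x \<notin> {''rank''} \<Longrightarrow> s6 x = s5 x" "s6 ''rank'' = (s4 ''rank'')(a := priority z a k)"
              have s6: "s6 ''a'' 0 = a" "s6 ''s'' 0 = k" "s6 ''tgt'' = s4 ''tgt''" using 5 6 za s4 by simp_all
              have "J (Suc k) (assign_store (assign_store s6 ''tgt'' a k) ''s'' 0 (Suc k))"
                unfolding J_def using le rk k 6(2) s6(3) by (simp add: ranked_def)
              then show "wp K (Assign ''tgt'' (var ''a'') (var ''s''))
                  (\<lambda>s'. J (Suc k) (assign_store s' ''s'' 0 (Suc k))) s6"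
                using s6(1,2) bounded_storeD[of s6 "''s''" 0]
                by (intro wp_Assign) (simp_all del: assign_store_apply)
            qed simp
          next
            case 2
            have le: "priority z a k \<le> s4 ''rank'' a" using 2 v by simp
            have "priority z a \<sigma> \<le> s4 ''rank'' a" if "\<sigma> < Suc k" for \<sigma>
              using le J4 that unfolding J_def by (cases "\<sigma> = k") simp_all
            then show ?case
              using 5 J4 by (intro wp_Skip) (simp add: J_def ranked_def)
          qed
        qed simp
      qed (use readyD(3)[OF ready3] m_le_K in simp_all)
      then show "wp K (for_loop ''s'' ''m'' (Seq ?p ?u)) (\<lambda>s'. s' ''a'' 0 = a \<and> ranked z (Suc a) s') s3"
      proof (rule wp_conseq)
        fix s' assume fr: "\<And>x. x \<notin> assigned (for_loop ''s'' ''m'' (Seq ?p ?u)) \<Longrightarrow> s' x = s3 x" and J: "J m s'"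
        have le: "priority z a \<sigma> \<le> s' ''rank'' a" if "\<sigma> < m" for \<sigma>
          using J that unfolding J_def by blast
        \<comment> \<open>If the recorded rank were still 0, all priorities would be 0, and the
          default target 0, a signal since \<open>m\<close> is positive, would attain the maximum as
          well.\<close>
        have t: "s' ''tgt'' a < m" "priority z a (s' ''tgt'' a) = s' ''rank'' a"
          using J m_pos le[of 0] unfolding J_def by fastforce+
        have "rank z a = s' ''rank'' a"
          by (rule rank_eqI[OF le t])
        moreover have "ranked z a s'" using J unfolding J_def by blast
        ultimately have "ranked z (Suc a) s'"
          using t unfolding ranked_def less_Suc_eq by force
        moreover have "s' ''a'' = s3 ''a''" by (rule fr) simp
        ultimately show "s' ''a'' 0 = a \<and> ranked z (Suc a) s'"
          using s3(2) by simp
      qed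
    qed simp
  qed simp
  then show "wp K (Seq (Assign ''rank'' (var ''a'') (Const 0)) (Seq (Assign ''tgt'' (var ''a'') (Const 0))
      (for_loop ''s'' ''m'' (Seq ?p ?u)))) (\<lambda>s''. ranked z (Suc a) (assign_store s'' ''a'' 0 (Suc a))) s1"
    by (rule wp_conseq) (simp add: ranked_def)
qed (use readyD(2)[OF ready] n_le_K in \<open>simp_all add: ranked_def\<close>)

lemma total_spec:
  assumes ready: "ready s" and ranked: "ranked z n s" and c: "1 \<le> c"
  shows "wp K (total_prog c) (\<lambda>s'. s' ''g'' 0 = total c z) s"
  unfolding total_prog_def
proof (rule wp_then[where A = "{''g''}" and P = "\<lambda>s'. s' ''g'' 0 = 0"])
  show "wp K (set_var ''g'' (Const 0)) (\<lambda>s'. s' ''g'' 0 = 0) s"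
    by (intro wp_Assign) simp_all
  fix s1 assume 1: "\<And>x. x \<notin> {''g''} \<Longrightarrow> s1 x = s x" "s1 ''g'' 0 = 0"
  have ready1: "ready s1" by (rule ready_cong[OF ready]) (use 1 in simp_all)
  define t where "t k = (\<Sum>a<k. of_bool (a \<in> acc I) * W a * (rank z a - c))" for k
  let ?e = "Plus (var ''g'') (Times (Times (acc_expr (var ''a'')) (Cell ''W'' (var ''a'')))
    (Monus (Cell ''rank'' (var ''a'')) (Const c)))"
  have "wp K (for_loop ''a'' ''n'' (set_var ''g'' ?e)) (\<lambda>s'. s' ''g'' 0 = t n) s1"
  proof (rule wp_for_loop[where A = "{''g''}" and J = "\<lambda>k s'. s' ''g'' 0 = t k"])
    fix k s2
    assume k: "k < n" and fr: "\<And>y. y \<notin> {''a'', ''g''} \<Longrightarrow> s2 y = s1 y"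
      and a: "s2 ''a'' 0 = k" and J: "s2 ''g'' 0 = t k"
    have ready2: "ready s2" by (rule ready_cong[OF ready1]) (use fr in simp_all)
    have "s2 ''rank'' k = rank z k" using ranked k fr 1 by (simp add: ranked_def)
    then have e: "val ?e s2 = t (Suc k)"
      using val_input(1)[OF readyD(1)[OF ready2], of "var ''a''" k] a k J readyD(6)[OF ready2 k]
      by (simp add: t_def)
    have "t (Suc k) \<le> 2 * 2 ^ L" unfolding t_def using k c by (intro total_partial_le) simp_all
    then have "t (Suc k) < 2 ^ K" by (intro less_pow_K) simp
    then show "wp K (set_var ''g'' ?e) (\<lambda>s'. assign_store s' ''a'' 0 (Suc k) ''g'' 0 = t (Suc k)) s2"
      using e by (intro wp_Assign) (simp_all del: val.simps(3))
  qed (use readyD(2)[OF ready1] n_le_K 1 in \<open>simp_all add: t_def\<close>)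
  then show "wp K (for_loop ''a'' ''n'' (set_var ''g'' ?e)) (\<lambda>s'. s' ''g'' 0 = total c z) s1"
    by (simp add: t_def total_def)
qed simp

lemma search_spec:
  assumes ready: "ready s"
  shows "wp K search_prog (\<lambda>s'. (r, s' ''zb'' 0) \<in> edges I \<and>
    (\<forall>z. (r, z) \<in> edges I \<longrightarrow> total 1 z \<le> total 1 (s' ''zb'' 0))) s"
  unfolding search_prog_def
proof (rule wp_then[where A = "{''best''}" and P = "\<lambda>s'. s' ''best'' 0 = 0"])
  show "wp K (set_var ''best'' (Const 0)) (\<lambda>s'. s' ''best'' 0 = 0) s"
    by (intro wp_Assign) simp_all
  fix s1 assume 1: "\<And>x. x \<notin> {''best''} \<Longrightarrow> s1 x = s x" "s1 ''best'' 0 = 0"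
  let ?u = "If (Monus (Plus (var ''g'') (Const 1)) (var ''best''))
            (Seq (set_var ''best'' (Plus (var ''g'') (Const 1))) (set_var ''zb'' (var ''z''))) Skip"
  let ?c = "If (edge_expr (var ''r'') (var ''z'')) (Seq rank_prog (Seq (total_prog 1) ?u)) Skip"
  show "wp K (Seq (set_var ''zb'' (Const 0)) (for_loop ''z'' ''m'' ?c)) (\<lambda>s'. (r, s' ''zb'' 0) \<in> edges I \<and>
    (\<forall>z. (r, z) \<in> edges I \<longrightarrow> total 1 z \<le> total 1 (s' ''zb'' 0))) s1"
  proof (rule wp_then[where A = "{''zb''}" and P = "\<lambda>_. True"])
    show "wp K (set_var ''zb'' (Const 0)) (\<lambda>_. True) s1" by (intro wp_Assign) simp_all
    fix s2 assume 2: "\<And>x. x \<notin> {''zb''} \<Longrightarrow> s2 x = s1 x"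
    have ready2: "ready s2" by (rule ready_cong[OF ready]) (use 1 2 in simp_all)
    \<comment> \<open>The inequality is strict because \<open>best\<close> exceeds the largest total
      by one.\<close>
    define J where "J k s' \<longleftrightarrow> (\<forall>z<k. (r, z) \<in> edges I \<longrightarrow> total 1 z < s' ''best'' 0) \<and>
      (s' ''best'' 0 = 0 \<or> (r, s' ''zb'' 0) \<in> edges I \<and> s' ''best'' 0 = Suc (total 1 (s' ''zb'' 0)))"
      for k and s' :: store
    have "wp K (for_loop ''z'' ''m'' ?c) (J m) s2"
    proof (rule wp_for_loop[where A = "{''best'', ''zb'', ''a'', ''rank'', ''tgt'', ''s'', ''p'', ''g''}"])
      show "J 0 (assign_store s2 ''z'' 0 0)" using 1 2 by (simp add: J_def)
      fix k s3
      assume k: "k < m" and z3: "s3 ''z'' 0 = k" and J3: "J k s3"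
        and 3: "\<And>y. y \<notin> {''z'', ''best'', ''zb'', ''a'', ''rank'', ''tgt'', ''s'', ''p'', ''g''} \<Longrightarrow> s3 y = s2 y"
      have ready3: "ready s3" by (rule ready_cong[OF ready2]) (use 3 in simp_all)
      have J_cong: "J (Suc k) (assign_store s' ''z'' 0 (Suc k)) = J (Suc k) s'" for s'
        by (simp add: J_def)
      have e: "val (edge_expr (var ''r'') (var ''z'')) s3 = of_bool ((r, k) \<in> edges I)"
        by (rule val_edge[OF ready3 _ r_less _ k]) (use readyD(4)[OF ready3] z3 in simp_all)
      show "wp K ?c (\<lambda>s'. J (Suc k) (assign_store s' ''z'' 0 (Suc k))) s3"
        unfolding J_cong
      proof (rule wp_If, goal_cases)
        case 1
        then have rk: "(r, k) \<in> edges I" using e by simp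
        show ?case
        proof (rule wp_then[where A = "{''a'', ''rank'', ''tgt'', ''s'', ''p''}", OF rank_spec[OF ready3 z3]])
          fix s4 assume 4: "\<And>x. x \<notin> {''a'', ''rank'', ''tgt'', ''s'', ''p''} \<Longrightarrow> s4 x = s3 x" "ranked k n s4"
          have ready4: "ready s4" by (rule ready_cong[OF ready3]) (use 4 in simp_all)
          show "wp K (Seq (total_prog 1) ?u) (J (Suc k)) s4"
          proof (rule wp_then[where A = "{''g'', ''a''}", OF total_spec[OF ready4 4(2) order_refl]])
            fix s5 assume 5: "\<And>x. x \<notin> {''g'', ''a''} \<Longrightarrow> s5 x = s4 x" "s5 ''g'' 0 = total 1 k"
            have s5: "s5 ''best'' = s3 ''best''" "s5 ''zb'' = s3 ''zb''" "s5 ''z'' 0 = k"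
              using 4 5 z3 by simp_all
            show "wp K ?u (J (Suc k)) s5"
            proof (rule wp_If, goal_cases)
              case 1
              then have gt: "s3 ''best'' 0 \<le> total 1 k" using 5 s5 by simp
              have le: "total 1 z < Suc (total 1 k)" if "z < Suc k" "(r, z) \<in> edges I" for z
              proof (cases "z = k")
                case False
                then have "total 1 z < s3 ''best'' 0" using J3 that unfolding J_def by simp
                then show ?thesis using gt by linarith
              qed simp
              have "Suc (total 1 k) \<le> 7 * 2 ^ L"
                using total_le[of 1 k] one_le_power[of "2::nat" L] by linarith
              then have b: "Suc (total 1 k) < 2 ^ K" by (rule less_pow_K)
              have "wp K (set_var ''best'' (Plus (var ''g'') (Const 1))) (\<lambda>s'. s' ''best'' 0 = Suc (total 1 k)) s5"
                using 5 b by (intro wp_Assign) simp_all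
              then show ?case
              proof (rule wp_then[where A = "{''best''}"])
                fix s6 assume 6: "\<And>x. x \<notin> {''best''} \<Longrightarrow> s6 x = s5 x" "s6 ''best'' 0 = Suc (total 1 k)"
                have z6: "s6 ''z'' 0 = k" using 6 s5 by simp
                have "J (Suc k) (assign_store s6 ''zb'' 0 k)"
                  unfolding J_def using le rk 6 by simp
                then show "wp K (set_var ''zb'' (var ''z'')) (J (Suc k)) s6"
                  using z6 bounded_storeD[of s6 "''z''" 0]
                  by (intro wp_Assign) (simp_all del: assign_store_apply)
              qed simp
            next
              case 2
              then have lt: "total 1 k < s3 ''best'' 0" using 5 s5 by simp
              have "total 1 z < s3 ''best'' 0" if "z < Suc k" "(r, z) \<in> edges I" for z
              proof (cases "z = k")
                case False
                then have "z < k" using that by simp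
                then show ?thesis using J3 that unfolding J_def by blast
              qed (use lt in simp)
              then show ?case using J3 s5 by (intro wp_Skip) (simp add: J_def)
            qed
          qed simp
        qed simp
      next
        case 2
        then have "(r, k) \<notin> edges I" using e by simp
        then show ?case using J3 by (intro wp_Skip) (auto simp: J_def less_Suc_eq)
      qed
    qed (use readyD(3)[OF ready2] m_le_K in simp_all)
    then show "wp K (for_loop ''z'' ''m'' ?c) (\<lambda>s'. (r, s' ''zb'' 0) \<in> edges I \<and>
      (\<forall>z. (r, z) \<in> edges I \<longrightarrow> total 1 z \<le> total 1 (s' ''zb'' 0))) s2"
    proof (rule wp_conseq)
      fix s' assume J: "J m s'"
      obtain z where "(r, z) \<in> edges I"
        using nbs_state_nonempty[of r] by (auto simp: nbs_state_def states_eq)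
      \<comment> \<open>\<open>r\<close> has at least one signal, and its total is strictly below
        \<open>best\<close>, so a signal has been recorded.\<close>
      then have "s' ''best'' 0 \<noteq> 0" using J edges_less unfolding J_def by fastforce
      then have "(r, s' ''zb'' 0) \<in> edges I" "s' ''best'' 0 = Suc (total 1 (s' ''zb'' 0))"
        using J unfolding J_def by auto
      moreover have "total 1 z < s' ''best'' 0" if "(r, z) \<in> edges I" for z
        using J that edges_less[OF that] unfolding J_def by blast
      ultimately show "(r, s' ''zb'' 0) \<in> edges I \<and>
        (\<forall>z. (r, z) \<in> edges I \<longrightarrow> total 1 z \<le> total 1 (s' ''zb'' 0))"
        by (simp add: less_Suc_eq_le)
    qed
  qed simp
qed simp

lemma choose_spec:
  assumes ready: "ready s" and b: "s ''zb'' 0 = b"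
  shows "wp K choose_prog (\<lambda>s'. ranked (s' ''z'' 0) n s' \<and>
    (W r \<le> total 2 m \<and> s' ''z'' 0 = m \<or> total 2 m < W r \<and> s' ''z'' 0 = b)) s"
  unfolding choose_prog_def
proof (rule wp_then[where A = "{''z''}" and P = "\<lambda>s'. s' ''z'' 0 = m"])
  show "wp K (set_var ''z'' (var ''m'')) (\<lambda>s'. s' ''z'' 0 = m) s"
    using readyD(3)[OF ready] le_K_less_pow[OF m_le_K] by (intro wp_Assign) simp_all
  fix s1 assume 1: "\<And>x. x \<notin> {''z''} \<Longrightarrow> s1 x = s x" "s1 ''z'' 0 = m"
  let ?u = "If (Monus (Plus (var ''g'') (Const 1)) (Cell ''W'' (var ''r''))) Skip (set_var ''z'' (var ''zb''))"
  let ?Q = "\<lambda>s'. ranked (s' ''z'' 0) n s' \<and>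
    (W r \<le> total 2 m \<and> s' ''z'' 0 = m \<or> total 2 m < W r \<and> s' ''z'' 0 = b)"
  have ready1: "ready s1" by (rule ready_cong[OF ready]) (use 1 in simp_all)
  show "wp K (Seq rank_prog (Seq (total_prog 2) (Seq ?u rank_prog))) ?Q s1"
  proof (rule wp_then[where A = "{''a'', ''rank'', ''tgt'', ''s'', ''p''}", OF rank_spec[OF ready1 1(2)]])
    fix s2 assume 2: "\<And>x. x \<notin> {''a'', ''rank'', ''tgt'', ''s'', ''p''} \<Longrightarrow> s2 x = s1 x" "ranked m n s2"
    have ready2: "ready s2" by (rule ready_cong[OF ready1]) (use 2 in simp_all)
    show "wp K (Seq (total_prog 2) (Seq ?u rank_prog)) ?Q s2"
    proof (rule wp_then[where A = "{''g'', ''a''}", OF total_spec[OF ready2 2(2), of 2]])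
      fix s3 assume 3: "\<And>x. x \<notin> {''g'', ''a''} \<Longrightarrow> s3 x = s2 x" "s3 ''g'' 0 = total 2 m"
      have ready3: "ready s3" by (rule ready_cong[OF ready2]) (use 3 in simp_all)
      have s3: "s3 ''z'' 0 = m" "s3 ''zb'' 0 = b" "s3 ''W'' (s3 ''r'' 0) = W r"
        using 1 2 3 b readyD(4,6)[OF ready3] r_less by simp_all
      let ?P = "\<lambda>s'. W r \<le> total 2 m \<and> s' ''z'' 0 = m \<or> total 2 m < W r \<and> s' ''z'' 0 = b"
      show "wp K (Seq ?u rank_prog) ?Q s3"
      proof (rule wp_then[where A = "{''z''}" and P = ?P])
        show "wp K ?u ?P s3"
        proof (rule wp_If, goal_cases)
          case 1
          then show ?case using 3 s3 by (intro wp_Skip) simp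
        next
          case 2
          then show ?case using 3 s3 bounded_storeD[of s3 "''zb''" 0] by (intro wp_Assign) simp_all
        qed
        fix s4 assume 4: "\<And>x. x \<notin> {''z''} \<Longrightarrow> s4 x = s3 x" "?P s4"
        have ready4: "ready s4" by (rule ready_cong[OF ready3]) (use 4 in simp_all)
        show "wp K rank_prog ?Q s4"
        proof (rule wp_conseq[OF rank_spec[OF ready4 refl]])
          fix s' assume fr: "\<And>x. x \<notin> assigned rank_prog \<Longrightarrow> s' x = s4 x" and R: "ranked (s4 ''z'' 0) n s'"
          have "s' ''z'' = s4 ''z''" by (rule fr) simp
          then show "?Q s'" using R 4(2) by simp
        qed
      qed simp
    qed simp_all
  qed simp
qed simp

section \<open>Writing the output table\<close>

definition cleared :: "store \<Rightarrow> bool" where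
  "cleared s \<longleftrightarrow> s ''k'' 0 = n * m \<and> (\<forall>j<n * m. s ''out'' (2 * j + 1) = D)"

lemma clear_spec:
  assumes ready: "ready s"
  shows "wp K clear_prog (\<lambda>s'. cleared s' \<and> (\<forall>j<n * m. s' ''out'' (2 * j) = 0)) s"
  unfolding clear_prog_def
proof (rule wp_then[where A = "{''k''}" and P = "\<lambda>s'. s' ''k'' 0 = n * m"])
  show "wp K (set_var ''k'' (Times (var ''n'') (var ''m''))) (\<lambda>s'. s' ''k'' 0 = n * m) s"
    using readyD(2,3)[OF ready] le_K_less_pow[OF nm_le_K] by (intro wp_Assign) simp_all
  fix s1 assume 1: "\<And>x. x \<notin> {''k''} \<Longrightarrow> s1 x = s x" "s1 ''k'' 0 = n * m"
  let ?c = "Seq (Assign ''out'' (Times (Const 2) (var ''j'')) (Const 0))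
        (Assign ''out'' (Plus (Times (Const 2) (var ''j'')) (Const 1)) (var ''D''))"
  define J where "J k s' \<longleftrightarrow> (\<forall>j<k. s' ''out'' (2 * j) = 0 \<and> s' ''out'' (2 * j + 1) = D)"
    for k and s' :: store
  have D1: "s1 ''D'' 0 = D" using 1 readyD(5)[OF ready] by simp
  have "wp K (for_loop ''j'' ''k'' ?c) (J (n * m)) s1"
  proof (rule wp_for_loop[where A = "{''out''}"])
    show "J 0 (assign_store s1 ''j'' 0 0)" by (simp add: J_def)
    fix k s2
    assume k: "k < n * m" and 2: "\<And>y. y \<notin> {''j'', ''out''} \<Longrightarrow> s2 y = s1 y"
      and j: "s2 ''j'' 0 = k" and J2: "J k s2"
    have "wp K (Assign ''out'' (Times (Const 2) (var ''j'')) (Const 0))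
        (\<lambda>s'. s' ''out'' = (s2 ''out'')(2 * k := 0)) s2"
      using j by (intro wp_Assign) simp_all
    then show "wp K ?c (\<lambda>s'. J (Suc k) (assign_store s' ''j'' 0 (Suc k))) s2"
    proof (rule wp_then[where A = "{''out''}"])
      fix s3 assume 3: "\<And>x. x \<notin> {''out''} \<Longrightarrow> s3 x = s2 x" "s3 ''out'' = (s2 ''out'')(2 * k := 0)"
      have s3: "s3 ''j'' 0 = k" "s3 ''D'' 0 = D" using 2 3 j D1 by simp_all
      have odd_even: "Suc (2 * i) \<noteq> 2 * i'" "2 * i \<noteq> Suc (2 * i')" for i i' :: nat by presburger+
      have "J (Suc k) (assign_store (assign_store s3 ''out'' (2 * k + 1) D) ''j'' 0 (Suc k))"
        using J2 3(2) unfolding J_def by (simp add: less_Suc_eq odd_even)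
      then show "wp K (Assign ''out'' (Plus (Times (Const 2) (var ''j'')) (Const 1)) (var ''D''))
        (\<lambda>s'. J (Suc k) (assign_store s' ''j'' 0 (Suc k))) s3"
        using s3 bounded_storeD[of s3 "''D''" 0] by (intro wp_Assign) (simp_all del: assign_store_apply)
    qed simp
  qed (use 1 nm_le_K in simp_all)
  then show "wp K (for_loop ''j'' ''k'' ?c) (\<lambda>s'. cleared s' \<and> (\<forall>j<n * m. s' ''out'' (2 * j) = 0)) s1"
  proof (rule wp_conseq)
    fix s' assume fr: "\<And>x. x \<notin> assigned (for_loop ''j'' ''k'' ?c) \<Longrightarrow> s' x = s1 x" and J: "J (n * m) s'"
    have "s' ''k'' = s1 ''k''" by (rule fr) simp
    then show "cleared s' \<and> (\<forall>j<n * m. s' ''out'' (2 * j) = 0)"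
      using J 1(2) by (simp add: cleared_def J_def)
  qed
qed simp

definition table :: "store \<Rightarrow> nat \<Rightarrow> nat \<Rightarrow> nat" where
  "table s a \<sigma> = s ''out'' (2 * (a * m + \<sigma>))"

text \<open>Row-major positions determine row and column only for columns below \<open>m\<close>; a
  column equal to \<open>m\<close> would alias the start of the next row.\<close>

lemma table_update:
  assumes "s' ''out'' = (s ''out'')(2 * (a * m + \<sigma>) := v)" and "\<sigma> < m" "\<tau> < m"
  shows "table s' b \<tau> = (if b = a \<and> \<tau> = \<sigma> then v else table s b \<tau>)"
  using row_index_eq_iff[OF assms(3,2), of b a] assms(1) by (auto simp: table_def)

text \<open>Numerators are at even positions, so updating them preserves the denominators.\<close>

lemma cleared_update:
  assumes "cleared s" and "s' ''out'' = (s ''out'')(2 * i := v)" and "s' ''k'' = s ''k''"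
  shows "cleared s'"
proof -
  have "2 * j + 1 \<noteq> 2 * i" for j :: nat by presburger
  then show ?thesis using assms by (simp add: cleared_def)
qed

lemma fill_spec:
  assumes ready: "ready s" and ranked: "ranked z n s" and clear: "cleared s"
    and zero: "\<forall>j<n * m. s ''out'' (2 * j) = 0"
  shows "wp K fill_prog (\<lambda>s'. cleared s' \<and> filled z (s' ''tgt'') n (table s') (s' ''R'' 0)) s"
  unfolding fill_prog_def
proof (rule wp_then[where A = "{''R''}" and P = "\<lambda>s'. s' ''R'' 0 = W r"])
  show "wp K (set_var ''R'' (Cell ''W'' (var ''r''))) (\<lambda>s'. s' ''R'' 0 = W r) s"
    using readyD(4,6)[OF ready] r_less bounded_storeD[of s "''W''" r] by (intro wp_Assign) simp_all
  fix s1 assume 1: "\<And>x. x \<notin> {''R''} \<Longrightarrow> s1 x = s x" "s1 ''R'' 0 = W r"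
  have ready1: "ready s1" by (rule ready_cong[OF ready]) (use 1 in simp_all)
  define T where "T = s ''tgt''"
  let ?v = "Seq (Assign ''out'' hidden_index (Plus (Cell ''out'' hidden_index)
                (Monus (var ''R'') (Monus (var ''R'') (Cell ''W'' (var ''a''))))))
            (set_var ''R'' (Monus (var ''R'') (Cell ''W'' (var ''a''))))"
  let ?u = "If (Monus (Cell ''rank'' (var ''a'')) (Const 2)) ?v Skip"
  let ?c = "If (acc_expr (var ''a'')) (Seq (Assign ''out'' (out_index (var ''a'') (Cell ''tgt'' (var ''a'')))
      (Cell ''W'' (var ''a''))) ?u) Skip"
  define J where "J k s' \<longleftrightarrow> cleared s' \<and> filled z T k (table s') (s' ''R'' 0)" for k and s' :: store
  have J_cong: "J k (assign_store s' ''a'' 0 j) = J k s'" for k s' j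
    by (simp add: J_def cleared_def table_def[abs_def])
  have "wp K (for_loop ''a'' ''n'' ?c) (J n) s1"
  proof (rule wp_for_loop[where A = "{''out'', ''R''}"])
    have "table s1 b \<sigma> = 0" if "b < n" "\<sigma> < m" for b \<sigma>
    proof -
      have "s1 ''out'' = s ''out''" using 1 by simp
      then show ?thesis
        using zero[rule_format, OF row_index_less[OF that]] by (simp only: table_def)
    qed
    then have "filled z T 0 (table s1) (W r)" by (rule filled_0)
    moreover have "cleared s1" using clear 1 by (simp add: cleared_def)
    ultimately show "J 0 (assign_store s1 ''a'' 0 0)" using 1 by (simp only: J_cong) (simp add: J_def)
    fix k s2
    assume k: "k < n" and 2: "\<And>y. y \<notin> {''a'', ''out'', ''R''} \<Longrightarrow> s2 y = s1 y"
      and a2: "s2 ''a'' 0 = k" and J2: "J k s2"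
    have ready2: "ready s2" by (rule ready_cong[OF ready1]) (use 2 in simp_all)
    have F2: "filled z T k (table s2) (s2 ''R'' 0)" "cleared s2" using J2 by (simp_all add: J_def)
    have T2: "s2 ''tgt'' = T" using 1 2 by (simp add: T_def)
    have Tk: "T k < m" using ranked k by (simp add: ranked_def T_def)
    have e: "val (acc_expr (var ''a'')) s2 = of_bool (k \<in> acc I)"
      by (rule val_input(1)[OF readyD(1)[OF ready2] _ k]) (use a2 in simp)
    show "wp K ?c (\<lambda>s'. J (Suc k) (assign_store s' ''a'' 0 (Suc k))) s2"
      unfolding J_cong
    proof (rule wp_If, goal_cases)
      case 1
      then have acc: "k \<in> acc I" using e by simp
      have kr: "k \<noteq> r" using acc r_not_acc by auto
      have "wp K (Assign ''out'' (out_index (var ''a'') (Cell ''tgt'' (var ''a''))) (Cell ''W'' (var ''a'')))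
          (\<lambda>s'. s' ''out'' = (s2 ''out'')(2 * (k * m + T k) := W k)) s2"
        using readyD(3,6)[OF ready2] k a2 T2 bounded_storeD[of s2 "''W''" k]
        by (intro wp_Assign) (simp_all add: out_index_def)
      then show ?case
      proof (rule wp_then[where A = "{''out''}"])
        fix s3 assume 3: "\<And>x. x \<notin> {''out''} \<Longrightarrow> s3 x = s2 x" "s3 ''out'' = (s2 ''out'')(2 * (k * m + T k) := W k)"
        have ready3: "ready s3" by (rule ready_cong[OF ready2]) (use 3 in simp_all)
        have clear3: "cleared s3" by (rule cleared_update[of s2 s3 "k * m + T k" "W k"]) (use 3 F2(2) in simp_all)
        have s3: "s3 ''a'' 0 = k" "s3 ''tgt'' = T" "s3 ''R'' = s2 ''R''" "s3 ''rank'' k = rank z k"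
          "s3 ''r'' 0 = r" "s3 ''m'' 0 = m" "s3 ''W'' k = W k" "s3 ''k'' = s2 ''k''"
          using 1 2 3 a2 T2 ranked k readyD(3,4,6)[OF ready3] \<open>\<And>x. x \<notin> {''R''} \<Longrightarrow> s1 x = s x\<close>
          by (simp_all add: ranked_def)
        have t3: "table s3 b \<tau> = (if b = k \<and> \<tau> = T k then W k else table s2 b \<tau>)" if "\<tau> < m" for b \<tau>
          by (rule table_update[of s3 s2 k "T k" "W k" \<tau> b, OF 3(2) Tk that])
        show "wp K ?u (J (Suc k)) s3"
        proof (rule wp_If, goal_cases)
          case 1
          then have rank: "rank z k = 3"
            using s3 rank_bounds[of k z] k states_n by simp
          let ?R = "s2 ''R'' 0"
          let ?w = "table s2 r (T k) + (?R - (?R - W k))"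
          \<comment> \<open>The preceding write went to row \<open>k\<close>, which is not the row
            of \<open>r\<close>.\<close>
          have old: "s3 ''out'' (2 * (r * m + T k)) = table s2 r (T k)"
            using t3[OF Tk, of r] kr by (simp add: table_def)
          have "?w \<le> W r" using filled_row_le[OF F2(1) Tk] by linarith
          then have b: "?w < 2 ^ K" using W_le[OF r_less] D_le by (intro less_pow_K) linarith
          have "wp K (Assign ''out'' hidden_index (Plus (Cell ''out'' hidden_index)
                (Monus (var ''R'') (Monus (var ''R'') (Cell ''W'' (var ''a''))))))
              (\<lambda>s'. s' ''out'' = (s3 ''out'')(2 * (r * m + T k) := ?w)) s3"
            using s3 old b by (intro wp_Assign) (simp_all add: out_index_def)
          then show ?case
          proof (rule wp_then[where A = "{''out''}"])
            fix s4 assume 4: "\<And>x. x \<notin> {''out''} \<Longrightarrow> s4 x = s3 x"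
              "s4 ''out'' = (s3 ''out'')(2 * (r * m + T k) := ?w)"
            have clear4: "cleared s4" by (rule cleared_update[of s3 s4 "r * m + T k" ?w]) (use 4 clear3 in simp_all)
            have t4: "table s4 b \<tau> = (if b = r \<and> \<tau> = T k then ?w else table s3 b \<tau>)" if "\<tau> < m" for b \<tau>
              by (rule table_update[of s4 s3 r "T k" ?w \<tau> b, OF 4(2) Tk that])
            have "filled z T (Suc k) (table s4) (?R - W k)"
              by (rule filled_high[OF F2(1) acc rank Tk]) (use t3 t4 kr in auto)
            moreover have "table (assign_store s4 ''R'' 0 x) = table s4" for x
              by (simp add: table_def[abs_def])
            ultimately have "J (Suc k) (assign_store s4 ''R'' 0 (?R - W k))"
              using clear4 by (simp add: J_def cleared_def)
            moreover have "val (Monus (var ''R'') (Cell ''W'' (var ''a''))) s4 = ?R - W k"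
              using 4 s3 by simp
            moreover have "?R - W k < 2 ^ K" if "bounded_store K s4"
            proof -
              have "?R < 2 ^ K" using bounded_storeD[OF that, of "''R''" 0] 4 s3 by simp
              then show ?thesis by linarith
            qed
            ultimately show "wp K (set_var ''R'' (Monus (var ''R'') (Cell ''W'' (var ''a'')))) (J (Suc k)) s4"
              by (intro wp_Assign) (simp_all only: val.simps(1))
          qed simp
        next
          case 2
          then have "rank z k \<noteq> 3" using s3 by simp
          then have "filled z T (Suc k) (table s3) (s2 ''R'' 0)"
            by (rule filled_low[OF F2(1) acc]) (use t3 in simp)
          then show ?case using clear3 s3 by (intro wp_Skip) (simp add: J_def)
        qed
      qed simp
    next
      case 2
      then have "k \<notin> acc I" using e by simp
      then show ?case using filled_rej[OF F2(1) k] F2(2) by (intro wp_Skip) (simp add: J_def)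
    qed
  qed (use readyD(2)[OF ready1] n_le_K in \<open>simp_all add: out_index_def\<close>)
  then show "wp K (for_loop ''a'' ''n'' ?c)
    (\<lambda>s'. cleared s' \<and> filled z (s' ''tgt'') n (table s') (s' ''R'' 0)) s1"
  proof (rule wp_conseq)
    fix s' assume fr: "\<And>x. x \<notin> assigned (for_loop ''a'' ''n'' ?c) \<Longrightarrow> s' x = s1 x" and J: "J n s'"
    have "s' ''tgt'' = s1 ''tgt''" by (rule fr) simp
    then show "cleared s' \<and> filled z (s' ''tgt'') n (table s') (s' ''R'' 0)"
      using J 1 by (simp add: J_def T_def)
  qed
qed simp

lemma persuasion_prog_spec:
  "wp K persuasion_prog (\<lambda>s. s ''outlen'' 0 \<le> 2 * L \<and> encodes_optimal_scheme I (output_of s)) (input_store xs)"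
  (is "wp K _ ?Q ?s0")
  unfolding persuasion_prog_def
proof (rule wp_then[OF setup_spec order_refl])
  show "input_loaded ?s0" by (simp add: input_loaded_def input_store_def)
  fix s1 assume ready1: "ready s1"
  show "wp K (Seq search_prog (Seq choose_prog (Seq clear_prog (Seq fill_prog finish_prog)))) ?Q s1"
  proof (rule wp_then[OF search_spec[OF ready1] order_refl])
    fix s2 assume 2: "\<And>x. x \<notin> assigned search_prog \<Longrightarrow> s2 x = s1 x"
      "(r, s2 ''zb'' 0) \<in> edges I \<and> (\<forall>z. (r, z) \<in> edges I \<longrightarrow> total 1 z \<le> total 1 (s2 ''zb'' 0))"
    have ready2: "ready s2" by (rule ready_cong[OF ready1]) (rule 2(1), simp)+
    show "wp K (Seq choose_prog (Seq clear_prog (Seq fill_prog finish_prog))) ?Q s2"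
    proof (rule wp_then[OF choose_spec[OF ready2 refl] order_refl])
      fix s3 assume 3: "\<And>x. x \<notin> assigned choose_prog \<Longrightarrow> s3 x = s2 x"
        "ranked (s3 ''z'' 0) n s3 \<and> (W r \<le> total 2 m \<and> s3 ''z'' 0 = m \<or>
          total 2 m < W r \<and> s3 ''z'' 0 = s2 ''zb'' 0)"
      define z where "z = s3 ''z'' 0"
      have ready3: "ready s3" by (rule ready_cong[OF ready2]) (rule 3(1), simp)+
      have z: "W r \<le> total 2 m \<and> z = m \<or>
        total 2 m < W r \<and> (r, z) \<in> edges I \<and> (\<forall>z'. (r, z') \<in> edges I \<longrightarrow> total 1 z' \<le> total 1 z)"
        using 2(2) 3(2) unfolding z_def by auto
      have z_m: "z < m \<or> z = m" using z edges_less by blast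
      show "wp K (Seq clear_prog (Seq fill_prog finish_prog)) ?Q s3"
      proof (rule wp_then[OF clear_spec[OF ready3] order_refl])
        fix s4 assume 4: "\<And>x. x \<notin> assigned clear_prog \<Longrightarrow> s4 x = s3 x"
          "cleared s4 \<and> (\<forall>j<n * m. s4 ''out'' (2 * j) = 0)"
        have ready4: "ready s4" by (rule ready_cong[OF ready3]) (rule 4(1), simp)+
        have eq4: "s4 ''rank'' = s3 ''rank''" "s4 ''tgt'' = s3 ''tgt''" "s4 ''z'' = s3 ''z''"
          by (rule 4(1), simp)+
        have ranked4: "ranked z n s4" using 3(2) eq4 by (simp add: ranked_def z_def)
        show "wp K (Seq fill_prog finish_prog) ?Q s4"
        proof (rule wp_then[OF fill_spec[OF ready4 ranked4] order_refl])
          fix s5 assume 5: "\<And>x. x \<notin> assigned fill_prog \<Longrightarrow> s5 x = s4 x"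
            "cleared s5 \<and> filled z (s5 ''tgt'') n (table s5) (s5 ''R'' 0)"
          have ready5: "ready s5" by (rule ready_cong[OF ready4]) (rule 5(1), simp)+
          have eq5: "s5 ''rank'' = s4 ''rank''" "s5 ''tgt'' = s4 ''tgt''" "s5 ''z'' = s4 ''z''"
            by (rule 5(1), simp)+
          have T: "a < n \<Longrightarrow> s5 ''tgt'' a < m \<and> priority z a (s5 ''tgt'' a) = rank z a" for a
            using ranked4 eq5 by (simp add: ranked_def)
          define R where "R = s5 ''R'' 0"
          have F: "filled z (s5 ''tgt'') n (table s5) R" using 5(2) by (simp add: R_def)
          \<comment> \<open>The dummy column \<open>m\<close> of row \<open>r\<close> is a cell
            outside that row, so nothing may be added there. The covering mass
            \<open>total 2 m\<close> is exactly the mass subtracted from \<open>W r\<close>, so the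
            truncated remainder is 0.\<close>
          have R0: "R = 0" if "z = m"
          proof -
            have "W r \<le> total 2 z" using z that edges_less by blast
            moreover have "total 2 z = (\<Sum>b\<in>high z n. W b)"
            proof -
              have "total 2 z = (\<Sum>a\<in>acc I. W a * (rank z a - 2))"
                by (simp add: total_def mult.assoc sum_of_bool_acc)
              also have "\<dots> = (\<Sum>b\<in>high z n. W b)"
              proof (rule sum.mono_neutral_cong_right[OF finite_states(1)])
                show "\<forall>a\<in>acc I - high z n. W a * (rank z a - 2) = 0"
                proof
                  fix a assume a: "a \<in> acc I - high z n"
                  then have "rank z a \<noteq> 3" by (auto simp: high_def acc_eq)
                  moreover have "rank z a \<le> 3" using a rank_bounds[OF acc_in_states] by blast
                  ultimately show "W a * (rank z a - 2) = 0" by simp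
                qed
              qed (auto simp: high_def)
              finally show ?thesis .
            qed
            ultimately show ?thesis using F unfolding filled_def by simp
          qed
          have v5: "s5 ''r'' 0 = r" "s5 ''m'' 0 = m" "s5 ''z'' 0 = z" "s5 ''R'' 0 = R"
            using readyD(3,4)[OF ready5] eq5 eq4 by (simp_all add: z_def R_def)
          let ?i = "2 * (r * m + z)"
          let ?v = "s5 ''out'' ?i + R"
          have b: "?v < 2 ^ K" if B: "bounded_store K s5"
          proof (cases "z = m")
            case True
            then show ?thesis using R0 bounded_storeD[OF B, of "''out''" ?i] by simp
          next
            case False
            then have "table s5 r z + R \<le> W r" using z_m filled_row_le[OF F] by blast
            then have "?v \<le> W r" by (simp add: table_def)
            then show ?thesis using W_le[OF r_less] D_le by (intro less_pow_K) linarith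
          qed
          have "wp K (Assign ''out'' (out_index (var ''r'') (var ''z''))
              (Plus (Cell ''out'' (out_index (var ''r'') (var ''z''))) (var ''R'')))
              (\<lambda>s'. s' ''out'' = (s5 ''out'')(?i := ?v)) s5"
            using v5 b by (intro wp_Assign) (simp_all add: out_index_def)
          then show "wp K finish_prog ?Q s5"
            unfolding finish_prog_def
          proof (rule wp_then[OF _ order_refl])
            fix s6 assume 6: "\<And>x. x \<notin> assigned (Assign ''out'' (out_index (var ''r'') (var ''z''))
              (Plus (Cell ''out'' (out_index (var ''r'') (var ''z''))) (var ''R''))) \<Longrightarrow> s6 x = s5 x"
              "s6 ''out'' = (s5 ''out'')(?i := ?v)"
            have k6: "s6 ''k'' = s5 ''k''" by (rule 6(1)) simp
            have clear6: "cleared s6" by (rule cleared_update[of s5 s6 "r * m + z" ?v]) (use 5(2) 6(2) k6 in blast)+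
            have t6: "table s6 a \<sigma> = table s5 a \<sigma> + (if a = r \<and> \<sigma> = z then R else 0)" if "\<sigma> < m" for a \<sigma>
            proof (cases "z = m")
              case True
              then have "s6 ''out'' = s5 ''out''" using 6(2) R0 by simp
              then show ?thesis using True R0 by (simp add: table_def)
            next
              case False
              then have "z < m" using z_m by simp
              then have "table s6 a \<sigma> = (if a = r \<and> \<sigma> = z then ?v else table s5 a \<sigma>)"
                using table_update[of s6 s5 r z ?v \<sigma> a] 6(2) that by blast
              then show ?thesis by (simp add: table_def)
            qed
            let ?s = "assign_store s6 ''outlen'' 0 (2 * (n * m))"
            let ?ys = "output_of ?s"
            have ys: "length ?ys = 2 * (n * m)" "j < 2 * (n * m) \<Longrightarrow> ?ys ! j = s6 ''out'' j" for j
              by (simp_all add: output_of_def)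
            have odd: "?ys ! (2 * j + 1) = D" if "j < n * m" for j
              using that clear6 ys(2)[of "2 * j + 1"] by (simp add: cleared_def)
            have "optimal_scheme I (decode_scheme m ?ys)"
            proof (rule filled_optimal[OF F T z])
              fix a \<sigma> assume a: "a < n" "\<sigma> < m"
              have i: "a * m + \<sigma> < n * m" by (rule row_index_less[OF a])
              show "decode_scheme m ?ys (a, \<sigma>) =
                real (table s5 a \<sigma> + (if a = r \<and> \<sigma> = z then R else 0)) / real D"
                using odd[OF i] ys(2)[of "2 * (a * m + \<sigma>)"] i t6[OF a(2), of a]
                by (simp add: decode_scheme_def table_def)
            qed
            moreover have "?ys ! (2 * j + 1) \<noteq> 0" if "j < n * m" for j
              using odd[OF that] D_pos by simp
            ultimately have "encodes_optimal_scheme I ?ys"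
              using ys(1) unfolding encodes_optimal_scheme_def n_def[symmetric] m_def[symmetric] Let_def
              by blast
            moreover have "2 * (n * m) < 2 ^ K"
            proof -
              have "n * m < 2 ^ L" using nm_le_L less_exp[of L] by linarith
              then show ?thesis by (intro less_pow_K) linarith
            qed
            moreover have "val (Times (Const 2) (var ''k'')) s6 = 2 * (n * m)"
              using clear6 by (simp add: cleared_def)
            moreover have "?s ''outlen'' 0 \<le> 2 * L" using nm_le_L by simp
            ultimately show "wp K (set_var ''outlen'' (Times (Const 2) (var ''k''))) ?Q s6"
              by (intro wp_Assign) (simp_all only: val.simps(1) simp_thms)
          qed
        qed (use 4(2) in blast)+
      qed
    qed
  qed
qed

end

theorem lemma5p10:
  shows "poly_time_solvable
           {I :: (nat, nat) persuasion. constrained_persuasion I \<and> unique_rejects I \<and> numbered I}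
           encode_instance encodes_optimal_scheme"
proof (rule poly_time_solvableI[where b = 3 and h = 2 and c = persuasion_prog])
  fix I :: "(nat, nat) persuasion"
  assume "I \<in> {I. constrained_persuasion I \<and> unique_rejects I \<and> numbered I}"
  then interpret encoded_instance I
    by unfold_locales auto
  \<comment> \<open>\<open>b = 3\<close> are the spare bits of \<open>K\<close>, and
    \<open>h = 2\<close> reflects the numerator and denominator written for each of the
    \<open>n * m\<close> pairs.\<close>
  show "bounded_store (list_size (encode_instance I) + 3) (input_store (encode_instance I))"
    using input_bounded by (simp only: L_def xs_def)
  show "wp (list_size (encode_instance I) + 3) persuasion_prog
      (\<lambda>s. s ''outlen'' 0 \<le> 2 * list_size (encode_instance I) \<and> encodes_optimal_scheme I (output_of s))
      (input_store (encode_instance I))"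
    using persuasion_prog_spec by (simp only: K_def L_def xs_def)
qed

end
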